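(* Let $K$ be a number field with ring of integers $\mathcal O_K$, and let $D\in K[X]$ be monic, not a square in $K[X]$, of even degree, and not Pellian over $K$. Let $\sqrt D=[a_0,a_1,a_2,\dots]$ be the continued fraction expansion of a square root $\sqrt D\in K((X^{-1}))$, with partial quotients $a_n\in K[X]$. Then for all but finitely many rational prime numbers $p$ there are infinitely many $n$ such that $p$ appears in the denominator of the leading coefficient $\mathrm{LC}(a_n)$, i.e. $\mathrm{LC}(a_n)$ cannot be written as $a/b$ with $a\in\mathcal O_K$ and $b\in\mathbb Z$ not divisible by $p$.
   Context: For a field $\mathbb K$ of characteristic $\neq 2$, $\mathbb K((X^{-1}))$ is the field of Laurent series $\sum_{n\le N}t_nX^n$ ($t_n\in\mathbb K$), with valuation $\operatorname{ord}$ given by $\operatorname{ord}(\sum_{n\le N}t_nX^n)=-N$ when $t_N\ne0$. For $\alpha\in\mathbb K((X^{-1}))$, $\lfloor\alpha\rfloor$ denotes the unique polynomial with $\operatorname{ord}(\alpha-\lfloor\alpha\rfloor)>0$. The continued fraction of $\alpha$ has complete quotients $\alpha_0=\alpha$, $\alpha_{n+1}=1/(\alpha_n-\lfloor\alpha_n\rfloor)$ (defined while $\alpha_n\notin\mathbb K[X]$) and partial quotients $a_n=\lfloor\alpha_n\rfloor$; we write $\alpha=[a_0,a_1,\dots]$. A monic polynomial of even degree has a square root in $K((X^{-1}))$. $D$ is called Pellian over $K$ if there exist $p,q\in K[X]$ with $q\neq0$ and $p^2-Dq^2\in K^*$ (equivalently $=1$). *)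

theory Defs
  imports "HOL-Computational_Algebra.Computational_Algebra"
begin

text \<open>The field K((X^{-1})) is modelled by the formal Laurent series type 'a fls in the
  variable t = X^{-1}.  A series sum_{n<=N} t_n X^n is the fls whose coefficient at t^{-n}
  is t_n.  Then ord coincides with fls_subdegree.\<close>

definition poly_to_lser :: "'a::field poly \<Rightarrow> 'a fls" where
  "poly_to_lser p = (\<Sum>i\<le>degree p. fls_const (coeff p i) * fls_X_inv ^ i)"

definition lser_ord :: "'a::field fls \<Rightarrow> int" where
  "lser_ord \<alpha> = fls_subdegree \<alpha>"

text \<open>Polynomial part: the unique polynomial with ord(alpha - floor alpha) > 0,
  i.e. the sum of the terms t_n X^n with n >= 0.\<close>
definition lser_floor :: "'a::field fls \<Rightarrow> 'a poly" where
  "lser_floor \<alpha> = (\<Sum>i\<le>nat (- lser_ord \<alpha>). monom (fls_nth \<alpha> (- int i)) i)"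

primrec cf_complete :: "'a::field fls \<Rightarrow> nat \<Rightarrow> 'a fls" where
  "cf_complete \<alpha> 0 = \<alpha>"
| "cf_complete \<alpha> (Suc n) =
     inverse (cf_complete \<alpha> n - poly_to_lser (lser_floor (cf_complete \<alpha> n)))"

definition cf_partial :: "'a::field fls \<Rightarrow> nat \<Rightarrow> 'a poly" where
  "cf_partial \<alpha> n = lser_floor (cf_complete \<alpha> n)"

definition pellian :: "'a::field poly \<Rightarrow> bool" where
  "pellian D \<longleftrightarrow> (\<exists>p q c. q \<noteq> 0 \<and> c \<noteq> 0 \<and> p\<^sup>2 - D * q\<^sup>2 = [:c:])"

definition number_field :: "'a::field_char_0 itself \<Rightarrow> bool" where
  "number_field TYPE('a) \<longleftrightarrow>
     (\<exists>B::'a set. finite B \<and> (\<forall>x::'a. \<exists>c. x = (\<Sum>b\<in>B. of_rat (c b) * b)))"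

definition alg_integer :: "'a::field_char_0 \<Rightarrow> bool" where
  "alg_integer x \<longleftrightarrow> (\<exists>f::int poly. lead_coeff f = 1 \<and> poly (map_poly of_int f) x = 0)"

definition p_in_denominator :: "nat \<Rightarrow> 'a::field_char_0 \<Rightarrow> bool" where
  "p_in_denominator p c \<longleftrightarrow>
     \<not> (\<exists>a b. alg_integer a \<and> \<not> int p dvd b \<and> c = a / of_int b)"

end

theory Submission
  imports Defs
begin

text \<open>Fix a valuation ring \<open>A\<close> of \<open>K\<close> above \<open>p\<close>, with maximal ideal \<open>\<mm>\<close>; its residue field is finite.  For almost
  all \<open>p\<close> the reduction of \<open>D\<close> is not a square, and a pigeonhole argument on the reduced convergents of
  \<open>\<surd>D\<close> yields solutions of the Pell equation modulo \<open>\<mm>\<close> of arbitrarily large degree.  Each of them is,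
  modulo \<open>\<mm>\<close>, the reduction of a suitably scaled convergent \<open>P/Q\<close> of \<open>\<surd>D\<close> over \<open>K\<close>, whose norm \<open>P\<^sup>2 - D Q\<^sup>2\<close>
  is not constant but becomes a nonzero constant modulo \<open>\<mm>\<close>.

  If \<open>N, N'\<close> are the norms of the (unscaled) convergents with indices \<open>n\<close> and \<open>n - 1\<close>, then \<open>N N' = M\<^sup>2 - D\<close> for a
  polynomial \<open>M\<close>, which turns out to be integral at such an index, and the leading coefficients of \<open>N, N'\<close>
  are \<open>\<plusminus>2\<close> divided by those of two consecutive partial quotients.  If the latter were both in \<open>A\<close>, then Gauss'
  lemma would force \<open>N\<close> to be integral with unit leading coefficient, and a nonconstant such \<open>N\<close> has no
  multiple whose reduction is a nonzero constant.\<close>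

unbundle fps_syntax

subsection \<open>Polynomials as Laurent series\<close>

lemma poly_to_lser_nth:
  "poly_to_lser p $$ n = (if n \<le> 0 then coeff p (nat (- n)) else 0)"
proof -
  have "poly_to_lser p $$ n = (\<Sum>i\<le>degree p. if n = - int i then coeff p i else 0)"
    unfolding poly_to_lser_def fls_nth_sum by (intro sum.cong) auto
  also have "\<dots> = (\<Sum>i\<in>{i. i \<le> degree p \<and> n = - int i}. coeff p i)"
    by (simp add: sum.If_cases Int_def)
  also have "\<dots> = (if n \<le> 0 then coeff p (nat (- n)) else 0)"
  proof (cases "n \<le> 0 \<and> nat (- n) \<le> degree p")
    case True
    then have "{i. i \<le> degree p \<and> n = - int i} = {nat (- n)}" by auto
    then show ?thesis using True by simp
  next
    case False
    then have "{i. i \<le> degree p \<and> n = - int i} = {}" by auto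
    moreover have "n \<le> 0 \<longrightarrow> coeff p (nat (- n)) = 0" using False by (auto intro: coeff_eq_0)
    ultimately show ?thesis by (simp only: sum.empty) auto
  qed
  finally show ?thesis .
qed

lemma poly_to_lser_nth_neg [simp]: "poly_to_lser p $$ (- int i) = coeff p i"
  by (simp add: poly_to_lser_nth)

lemma poly_to_lser_0 [simp]: "poly_to_lser 0 = 0"
  and poly_to_lser_1 [simp]: "poly_to_lser 1 = 1"
  and poly_to_lser_add [simp]: "poly_to_lser (p + q) = poly_to_lser p + poly_to_lser q"
  and poly_to_lser_diff [simp]: "poly_to_lser (p - q) = poly_to_lser p - poly_to_lser q"
  and poly_to_lser_minus [simp]: "poly_to_lser (- p) = - poly_to_lser p"
  by (auto intro!: fls_eqI simp: poly_to_lser_nth)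

lemma poly_to_lser_smult [simp]: "poly_to_lser (smult c p) = fls_const c * poly_to_lser p"
  by (rule fls_eqI) (auto simp: poly_to_lser_nth)

lemma poly_to_lser_pCons:
  "poly_to_lser (pCons a p) = fls_const a + fls_X_inv * poly_to_lser p"
proof (rule fls_eqI)
  fix n
  have "nat (- n) = Suc (nat (- (n + 1)))" if "n < 0" using that by auto
  then show "poly_to_lser (pCons a p) $$ n = (fls_const a + fls_X_inv * poly_to_lser p) $$ n"
    by (cases "n < 0") (auto simp: poly_to_lser_nth fls_X_inv_times_conv_shift coeff_pCons)
qed

lemma poly_to_lser_mult [simp]: "poly_to_lser (p * q) = poly_to_lser p * poly_to_lser q"
  by (induction p) (simp_all add: poly_to_lser_pCons algebra_simps)

lemma poly_to_lser_power [simp]: "poly_to_lser (p ^ n) = poly_to_lser p ^ n"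
  by (induction n) simp_all

lemma poly_to_lser_eq_iff [simp]: "poly_to_lser p = poly_to_lser q \<longleftrightarrow> p = q"
  by (metis poly_eqI poly_to_lser_nth_neg)

lemma poly_to_lser_eq_0_iff [simp]: "poly_to_lser p = 0 \<longleftrightarrow> p = 0"
  using poly_to_lser_eq_iff[of p 0] by simp

lemma subdegree_poly_to_lser [simp]: "fls_subdegree (poly_to_lser p) = - int (degree p)"
proof (cases "p = 0")
  case False
  then show ?thesis
    by (intro fls_subdegree_eqI) (auto simp: poly_to_lser_nth intro: coeff_eq_0)
qed simp

lemma base_poly_to_lser: "poly_to_lser p $$ fls_subdegree (poly_to_lser p) = lead_coeff p"
  by simp

subsection \<open>Valuation rings and reduction of Laurent series\<close>

text \<open>\<open>A\<close> may be the whole field. That case, with maximal ideal zero, later shows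
  that the square root of \<open>D\<close> is not a rational function.\<close>

locale valuation_subring =
  fixes A :: "'a::field set"
  assumes one_mem [simp, intro]: "1 \<in> A"
    and diff_mem [intro]: "x \<in> A \<Longrightarrow> y \<in> A \<Longrightarrow> x - y \<in> A"
    and mult_mem [intro]: "x \<in> A \<Longrightarrow> y \<in> A \<Longrightarrow> x * y \<in> A"
    and total: "x \<in> A \<or> inverse x \<in> A"
begin

text \<open>Zero is listed separately because \<open>inverse 0 = 0\<close> lies in
  \<open>A\<close>.\<close>

definition \<mm> :: "'a set" where "\<mm> = {x \<in> A. x = 0 \<or> inverse x \<notin> A}"

lemma zero_mem [simp, intro]: "0 \<in> A" using diff_mem[OF one_mem one_mem] by simp
lemma uminus_mem [intro]: "x \<in> A \<Longrightarrow> - x \<in> A" using diff_mem[OF zero_mem, of x] by simp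
lemma uminus_mem_iff [simp]: "- x \<in> A \<longleftrightarrow> x \<in> A" using uminus_mem[of x] uminus_mem[of "-x"] by auto
lemma add_mem [intro]: "x \<in> A \<Longrightarrow> y \<in> A \<Longrightarrow> x + y \<in> A" using diff_mem[of x "-y"] uminus_mem by simp
lemma sum_mem [intro]: "(\<And>i. i \<in> I \<Longrightarrow> f i \<in> A) \<Longrightarrow> sum f I \<in> A"
  by (induction I rule: infinite_finite_induct) auto
lemma power_mem [intro]: "x \<in> A \<Longrightarrow> x ^ n \<in> A"
  by (induction n) auto
lemma of_nat_mem [simp, intro]: "of_nat n \<in> A" by (induction n) auto
lemma of_int_mem [simp, intro]: "of_int n \<in> A" by (cases n) (auto simp del: of_nat_Suc)
lemma numeral_mem [simp, intro]: "numeral n \<in> A" using of_nat_mem[of "numeral n"] by simp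

lemma ideal_mem: "x \<in> \<mm> \<Longrightarrow> x \<in> A" by (simp add: \<mm>_def)
lemma zero_ideal [simp, intro]: "0 \<in> \<mm>" by (simp add: \<mm>_def)
lemma one_ideal [simp]: "1 \<notin> \<mm>" by (simp add: \<mm>_def)
lemma mult_ideal [intro]:
  assumes "x \<in> A" "y \<in> \<mm>" shows "x * y \<in> \<mm>"
proof -
  have "inverse y \<in> A" if "x * y \<noteq> 0" "inverse (x * y) \<in> A"
    using mult_mem[OF assms(1) that(2)] that(1) by (simp add: field_simps)
  then show ?thesis using assms unfolding \<mm>_def by auto
qed
lemma mult_ideal' [intro]: "x \<in> \<mm> \<Longrightarrow> y \<in> A \<Longrightarrow> x * y \<in> \<mm>"
  by (metis mult.commute mult_ideal)
lemma add_ideal [intro]: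
  assumes "x \<in> \<mm>" "y \<in> \<mm>" shows "x + y \<in> \<mm>"
proof -
  have *: "u + v \<in> \<mm>" if "u \<in> \<mm>" "v \<in> \<mm>" "u / v \<in> A" "v \<noteq> 0" for u v
  proof -
    have "u + v = (u / v + 1) * v" using that by (simp add: field_simps)
    then show ?thesis using that by (metis add_mem mult_ideal one_mem)
  qed
  have "x / y \<in> A \<or> y / x \<in> A" using total[of "x / y"] by simp
  then show ?thesis
    using assms *[of x y] *[of y x] by (cases "x = 0"; cases "y = 0") (auto simp: add.commute)
qed
lemma uminus_ideal [intro]: "x \<in> \<mm> \<Longrightarrow> - x \<in> \<mm>" using mult_ideal[of "-1" x] by (simp add: uminus_mem)
lemma uminus_ideal_iff [simp]: "- x \<in> \<mm> \<longleftrightarrow> x \<in> \<mm>" using uminus_ideal[of x] uminus_ideal[of "-x"] by auto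
lemma diff_ideal [intro]: "x \<in> \<mm> \<Longrightarrow> y \<in> \<mm> \<Longrightarrow> x - y \<in> \<mm>" using add_ideal[of x "-y"] by auto
lemma sum_ideal [intro]: "(\<And>i. i \<in> I \<Longrightarrow> f i \<in> \<mm>) \<Longrightarrow> sum f I \<in> \<mm>"
  by (induction I rule: infinite_finite_induct) auto

lemma unit_inverse: "x \<in> A \<Longrightarrow> x \<notin> \<mm> \<Longrightarrow> inverse x \<in> A" by (auto simp: \<mm>_def)
lemma not_ideal_inverse: "x \<in> A \<Longrightarrow> inverse x \<in> A \<Longrightarrow> x \<noteq> 0 \<Longrightarrow> x \<notin> \<mm>" by (auto simp: \<mm>_def)
lemma inverse_ideal: "x \<notin> A \<Longrightarrow> inverse x \<in> \<mm>"
  using total[of x] by (auto simp: \<mm>_def)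
lemma prime_ideal:
  assumes "x \<in> A" "y \<in> A" "x * y \<in> \<mm>" shows "x \<in> \<mm> \<or> y \<in> \<mm>"
proof (rule ccontr)
  assume "\<not> ?thesis"
  then have x: "x \<notin> \<mm>" "y \<notin> \<mm>" by auto
  then have "inverse x \<in> A" "x \<noteq> 0" using assms unit_inverse by auto
  then have "inverse x * (x * y) \<in> \<mm>" using assms by auto
  then show False using x \<open>x \<noteq> 0\<close> by (simp add: mult.assoc[symmetric])
qed

text \<open>Divisibility in a valuation ring is total, so some nonzero \<open>z\<close> in the
  finite set divides all the others; its inverse is the scaling factor.\<close>

lemma scale_finite:
  assumes "finite S" "\<exists>x\<in>S. x \<noteq> 0"
  obtains c where "c \<noteq> 0" "\<And>x. x \<in> S \<Longrightarrow> c * x \<in> A" "\<exists>x\<in>S. c * x = 1"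
proof -
  have "\<exists>z\<in>S. z \<noteq> 0 \<and> (\<forall>x\<in>S. x / z \<in> A)"
    using assms
  proof (induction S rule: finite_induct)
    case (insert y S)
    show ?case
    proof (cases "\<exists>x\<in>S. x \<noteq> 0")
      case True
      then obtain z where z: "z \<in> S" "z \<noteq> 0" "\<forall>x\<in>S. x / z \<in> A" using insert.IH by auto
      show ?thesis
      proof (cases "y / z \<in> A")
        case False
        then have y: "z / y \<in> A" "y \<noteq> 0" using total[of "y / z"] by auto
        have "x / y \<in> A" if "x \<in> S" for x
        proof -
          have "x / y = (x / z) * (z / y)" using z by simp
          then show ?thesis using that z y by (metis mult_mem)
        qed
        then show ?thesis using y by (intro bexI[of _ y]) auto
      qed (use z in auto)
    next
      case False
      then show ?thesis using insert.prems by (intro bexI[of _ y]) auto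
    qed
  qed simp
  then obtain z where "z \<in> S" "z \<noteq> 0" "\<forall>x\<in>S. x / z \<in> A" by blast
  then show thesis by (intro that[of "inverse z"]) (auto simp: field_simps)
qed

section \<open>Laurent series over the valuation ring and the order of their reductions\<close>

definition \<O> :: "'a fls set" where "\<O> = {f. \<forall>i. f $$ i \<in> A}"
definition \<M> :: "'a fls set" where "\<M> = {f. \<forall>i. f $$ i \<in> \<mm>}"

definition vanishes_below :: "'a fls \<Rightarrow> int \<Rightarrow> bool" where
  "vanishes_below f k \<longleftrightarrow> (\<forall>i<k. f $$ i \<in> \<mm>)"

text \<open>The reduction of \<open>f\<close> is a nonzero series of order exactly \<open>k\<close>,
  expressed without a type for the residue field. For a polynomial, \<open>-k\<close> is the degree
  of the reduction.\<close>

definition leads_at :: "'a fls \<Rightarrow> int \<Rightarrow> bool" where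
  "leads_at f k \<longleftrightarrow> f \<in> \<O> \<and> vanishes_below f k \<and> f $$ k \<notin> \<mm>"

lemma \<O>_1 [simp, intro]: "1 \<in> \<O>" by (auto simp: \<O>_def)
lemma \<O>_add [intro]: "f \<in> \<O> \<Longrightarrow> g \<in> \<O> \<Longrightarrow> f + g \<in> \<O>" by (auto simp: \<O>_def)
lemma \<O>_diff [intro]: "f \<in> \<O> \<Longrightarrow> g \<in> \<O> \<Longrightarrow> f - g \<in> \<O>" by (auto simp: \<O>_def)
lemma \<O>_uminus [intro]: "f \<in> \<O> \<Longrightarrow> - f \<in> \<O>" by (auto simp: \<O>_def)
lemma \<O>_mult [intro]: "f \<in> \<O> \<Longrightarrow> g \<in> \<O> \<Longrightarrow> f * g \<in> \<O>"
  by (auto simp: \<O>_def fls_times_nth(2))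
lemma \<O>_power [intro]: "f \<in> \<O> \<Longrightarrow> f ^ n \<in> \<O>" by (induction n) auto
lemma \<O>_const [intro]: "c \<in> A \<Longrightarrow> fls_const c \<in> \<O>" by (auto simp: \<O>_def)
lemma \<O>_numeral [simp, intro]: "numeral n \<in> \<O>"
proof -
  have "of_nat k \<in> \<O>" for k by (induction k) (auto simp: \<O>_def)
  from this[of "numeral n"] show ?thesis by simp
qed
lemma \<M>_\<O>: "f \<in> \<M> \<Longrightarrow> f \<in> \<O>" by (auto simp: \<O>_def \<M>_def ideal_mem)
lemma \<M>_0 [simp, intro]: "0 \<in> \<M>" by (auto simp: \<M>_def)
lemma \<M>_add [intro]: "f \<in> \<M> \<Longrightarrow> g \<in> \<M> \<Longrightarrow> f + g \<in> \<M>" by (auto simp: \<M>_def)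
lemma \<M>_diff [intro]: "f \<in> \<M> \<Longrightarrow> g \<in> \<M> \<Longrightarrow> f - g \<in> \<M>" by (auto simp: \<M>_def)
lemma \<M>_uminus [intro]: "f \<in> \<M> \<Longrightarrow> - f \<in> \<M>" by (auto simp: \<M>_def)
lemma \<M>_uminus_iff [simp]: "- f \<in> \<M> \<longleftrightarrow> f \<in> \<M>" by (auto simp: \<M>_def)
lemma \<M>_mult [intro]: "f \<in> \<O> \<Longrightarrow> g \<in> \<M> \<Longrightarrow> f * g \<in> \<M>"
  unfolding \<M>_def \<O>_def mem_Collect_eq fls_times_nth(2) by auto
lemma \<M>_mult' [intro]: "f \<in> \<M> \<Longrightarrow> g \<in> \<O> \<Longrightarrow> f * g \<in> \<M>" by (metis mult.commute \<M>_mult)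
lemma \<M>_const [intro]: "c \<in> \<mm> \<Longrightarrow> fls_const c \<in> \<M>" by (auto simp: \<M>_def)
lemma \<M>_nth: "f \<in> \<M> \<Longrightarrow> f $$ i \<in> \<mm>" by (auto simp: \<M>_def)
lemma \<O>_nth: "f \<in> \<O> \<Longrightarrow> f $$ i \<in> A" by (auto simp: \<O>_def)
lemma \<M>_cong: "f - g \<in> \<M> \<Longrightarrow> f \<in> \<M> \<longleftrightarrow> g \<in> \<M>"
  using \<M>_diff[of f "f - g"] \<M>_add[of "f - g" g] by auto

lemma vanishes_below_mult:
  assumes f: "f \<in> \<O>" "vanishes_below f k" and g: "g \<in> \<O>" "vanishes_below g l"
  shows "vanishes_below (f * g) (k + l)"
  unfolding vanishes_below_def
proof (intro allI impI)
  fix n assume n: "n < k + l"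
  have "f $$ i * g $$ (n - i) \<in> \<mm>" for i
  proof (cases "i < k")
    case False
    then have "n - i < l" using n by simp
    then show ?thesis using f g by (auto simp: vanishes_below_def \<O>_def)
  qed (use f g in \<open>auto simp: vanishes_below_def \<O>_def\<close>)
  then show "(f * g) $$ n \<in> \<mm>" unfolding fls_times_nth(2) by auto
qed

text \<open>In the coefficient at \<open>k + l\<close> every term except the one for
  \<open>i = k\<close> has a factor in \<mm>, and that one stays outside \<mm> because \<mm> is
  prime.\<close>

lemma leads_at_mult:
  assumes f: "leads_at f k" and g: "leads_at g l"
  shows "leads_at (f * g) (k + l)"
proof -
  have O: "f \<in> \<O>" "g \<in> \<O>" and van: "vanishes_below f k" "vanishes_below g l"
    and nz: "f $$ k \<notin> \<mm>" "g $$ l \<notin> \<mm>"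
    using f g by (auto simp: leads_at_def)
  let ?I = "{fls_subdegree f..k + l - fls_subdegree g}"
  have k: "fls_subdegree f \<le> k" "fls_subdegree g \<le> l"
    using nz by (auto intro!: fls_subdegree_leI)
  then have kI: "k \<in> ?I" by auto
  have "(f * g) $$ (k + l) = f $$ k * g $$ l + (\<Sum>i\<in>?I - {k}. f $$ i * g $$ (k + l - i))"
    unfolding fls_times_nth(2) by (subst sum.remove[OF _ kI]) auto
  moreover have "(\<Sum>i\<in>?I - {k}. f $$ i * g $$ (k + l - i)) \<in> \<mm>"
  proof (rule sum_ideal)
    fix i assume "i \<in> ?I - {k}"
    then have "i < k \<or> k + l - i < l" by auto
    then show "f $$ i * g $$ (k + l - i) \<in> \<mm>"
      using van O by (auto simp: vanishes_below_def \<O>_def)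
  qed
  moreover have "f $$ k * g $$ l \<notin> \<mm>" using prime_ideal nz O by (auto simp: \<O>_def)
  ultimately have "(f * g) $$ (k + l) \<notin> \<mm>" using diff_ideal by fastforce
  then show ?thesis
    using vanishes_below_mult[OF O(1) van(1) O(2) van(2)] O by (auto simp: leads_at_def)
qed

lemma leads_at_exists:
  assumes "f \<in> \<O>" "f \<notin> \<M>" obtains k where "leads_at f k"
proof -
  obtain j where j: "f $$ j \<notin> \<mm>" using assms by (auto simp: \<M>_def)
  define P where "P n \<longleftrightarrow> f $$ (fls_subdegree f + int n) \<notin> \<mm>" for n
  have "fls_subdegree f \<le> j" using j by (auto intro!: fls_subdegree_leI)
  then have "P (nat (j - fls_subdegree f))" using j by (simp add: P_def)
  then have P: "P (LEAST n. P n)" by (rule LeastI)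
  define k where "k = fls_subdegree f + int (LEAST n. P n)"
  have Pk: "f $$ k \<notin> \<mm>" using P unfolding P_def k_def .
  have "f $$ i \<in> \<mm>" if "i < k" for i
  proof (cases "i < fls_subdegree f")
    case False
    then have "nat (i - fls_subdegree f) < (LEAST n. P n)" using that by (auto simp: k_def)
    then have "\<not> P (nat (i - fls_subdegree f))" by (rule not_less_Least)
    then show ?thesis using False by (simp add: P_def)
  qed simp
  then have "leads_at f k"
    using assms(1) Pk by (auto simp: leads_at_def vanishes_below_def)
  then show thesis by (rule that)
qed

lemma leads_at_not_\<M>: "leads_at f k \<Longrightarrow> f \<notin> \<M>"
  by (auto simp: leads_at_def \<M>_def)

text \<open>A form of Gauss' lemma: the orders of two nonzero reductions add, so their product is
  nonzero.\<close>

lemma prime_\<M>: "f \<in> \<O> \<Longrightarrow> g \<in> \<O> \<Longrightarrow> f * g \<in> \<M> \<Longrightarrow> f \<in> \<M> \<or> g \<in> \<M>"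
  by (meson leads_at_exists leads_at_mult leads_at_not_\<M>)

lemma leads_at_unique: "leads_at f k \<Longrightarrow> leads_at f l \<Longrightarrow> k = l"
  by (metis leads_at_def linorder_neqE vanishes_below_def)

lemma leads_at_cong:
  assumes "leads_at f k" "f - g \<in> \<M>" shows "leads_at g k"
proof -
  have "g = f - (f - g)" by simp
  then have g: "g \<in> \<O>" using assms \<M>_\<O> by (metis \<O>_diff leads_at_def)
  have "g $$ i \<in> \<mm> \<longleftrightarrow> f $$ i \<in> \<mm>" for i
  proof -
    have "f $$ i - g $$ i \<in> \<mm>" using \<M>_nth[OF assms(2), of i] by simp
    then show ?thesis using diff_ideal[of "f $$ i" "f $$ i - g $$ i"] add_ideal[of "f $$ i - g $$ i" "g $$ i"] by auto
  qed
  then show ?thesis using assms g by (auto simp: leads_at_def vanishes_below_def)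
qed

lemma vanishes_below_add: "vanishes_below f k \<Longrightarrow> vanishes_below g k \<Longrightarrow> vanishes_below (f + g) k"
  and vanishes_below_diff: "vanishes_below f k \<Longrightarrow> vanishes_below g k \<Longrightarrow> vanishes_below (f - g) k"
  by (auto simp: vanishes_below_def)

lemma vanishes_below_mono: "vanishes_below f k \<Longrightarrow> l \<le> k \<Longrightarrow> vanishes_below f l"
  by (auto simp: vanishes_below_def)

lemma vanishes_below_leads: "leads_at f k \<Longrightarrow> vanishes_below f l \<Longrightarrow> l \<le> k"
  by (force simp: vanishes_below_def leads_at_def)

lemma vanishes_below_subdegree: "vanishes_below f (fls_subdegree f)"
  by (simp add: vanishes_below_def)

lemma leads_at_poly_nonpos: "leads_at (poly_to_lser p) k \<Longrightarrow> k \<le> 0"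
  by (rule ccontr) (auto simp: leads_at_def poly_to_lser_nth)

lemma leads_at_poly_ge: "leads_at (poly_to_lser p) k \<Longrightarrow> - int (degree p) \<le> k"
  using vanishes_below_leads[OF _ vanishes_below_subdegree] by fastforce

lemma \<O>_poly_iff: "poly_to_lser p \<in> \<O> \<longleftrightarrow> (\<forall>i. coeff p i \<in> A)"
  unfolding \<O>_def mem_Collect_eq
proof
  assume "\<forall>i. poly_to_lser p $$ i \<in> A"
  then show "\<forall>i. coeff p i \<in> A" by (metis poly_to_lser_nth_neg)
qed (simp add: poly_to_lser_nth)

lemma \<M>_poly_iff: "poly_to_lser p \<in> \<M> \<longleftrightarrow> (\<forall>i. coeff p i \<in> \<mm>)"
  unfolding \<M>_def mem_Collect_eq
proof
  assume "\<forall>i. poly_to_lser p $$ i \<in> \<mm>"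
  then show "\<forall>i. coeff p i \<in> \<mm>" by (metis poly_to_lser_nth_neg)
qed (simp add: poly_to_lser_nth)

text \<open>Polynomials have no coefficients at positive indices. Polynomials are shown to vanish
  modulo \<mm> by bounding their order and applying this.\<close>

lemma vanishes_below_1_poly: "vanishes_below (poly_to_lser p) 1 \<Longrightarrow> poly_to_lser p \<in> \<M>"
  by (auto simp: vanishes_below_def \<M>_def poly_to_lser_nth)

lemma scale_polys:
  assumes "p \<noteq> 0 \<or> q \<noteq> 0"
  obtains c where "c \<noteq> 0" "poly_to_lser (smult c p) \<in> \<O>" "poly_to_lser (smult c q) \<in> \<O>"
    "poly_to_lser (smult c p) \<notin> \<M> \<or> poly_to_lser (smult c q) \<notin> \<M>"
proof -
  let ?S = "set (coeffs p) \<union> set (coeffs q)"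
  have "\<exists>x\<in>?S. x \<noteq> 0"
    using assms by (metis UnI1 UnI2 coeffs_eq_Nil last_coeffs_eq_coeff_degree last_in_set leading_coeff_0_iff)
  then obtain c where c: "c \<noteq> 0" "\<And>x. x \<in> ?S \<Longrightarrow> c * x \<in> A" "\<exists>x\<in>?S. c * x = 1"
    by (rule scale_finite[rotated]) auto
  have mem: "c * coeff r i \<in> A" if "set (coeffs r) \<subseteq> ?S" for r i
  proof (cases "coeff r i = 0")
    case False
    then have "coeff r i \<in> set (coeffs r)" using range_coeff[of r] by auto
    then show ?thesis using c that by auto
  qed simp
  obtain x where x: "x \<in> ?S" "c * x = 1" using c by auto
  then have "(\<exists>i. x = coeff p i) \<or> (\<exists>i. x = coeff q i)"
    using range_coeff[of p] range_coeff[of q] by auto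
  then have "(\<exists>i. coeff (smult c p) i \<notin> \<mm>) \<or> (\<exists>i. coeff (smult c q) i \<notin> \<mm>)"
    using x(2) by (metis coeff_smult one_ideal)
  then show thesis
    using c mem by (intro that[of c]) (auto simp only: \<O>_poly_iff \<M>_poly_iff coeff_smult)
qed

end

subsection \<open>Valuation rings of a number field\<close>

lemma poly_map_of_int_altdef:
  fixes x :: "'a::comm_ring_1"
  assumes "degree f \<le> n"
  shows "poly (map_poly of_int f) x = (\<Sum>i\<le>n. of_int (coeff f i) * x ^ i)"
proof -
  have "degree (map_poly of_int f :: 'a poly) \<le> n"
    using assms by (intro degree_le) (auto simp: coeff_map_poly coeff_eq_0)
  then show ?thesis
    unfolding poly_altdef
    by (intro sum.mono_neutral_cong_left) (auto simp: coeff_map_poly intro: le_degree)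
qed

context valuation_subring
begin

text \<open>If \<open>x\<close> is not in \<open>A\<close>, then \<open>y = inverse x\<close> is in
  \<mm>, and multiplying the equation by \<open>y ^ n\<close> puts the leading coefficient into
  \<mm>.\<close>

lemma integral_mem:
  fixes f :: "int poly"
  assumes "of_int (lead_coeff f) \<notin> \<mm>" "poly (map_poly of_int f) x = 0"
  shows "x \<in> A"
proof (rule ccontr)
  assume x: "x \<notin> A"
  define y where "y = inverse x"
  have y: "y \<in> \<mm>" "x \<noteq> 0" using inverse_ideal[OF x] x by (auto simp: y_def)
  define n where "n = degree f"
  have "(\<Sum>i\<le>n. of_int (coeff f i) * x ^ i) = 0"
    using assms(2) poly_map_of_int_altdef[of f n x] by (simp add: n_def)
  then have "0 = y ^ n * (\<Sum>i\<le>n. of_int (coeff f i) * x ^ i)" by simp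
  also have "\<dots> = (\<Sum>i\<le>n. of_int (coeff f i) * y ^ (n - i))"
    unfolding sum_distrib_left
  proof (intro sum.cong refl)
    fix i assume "i \<in> {..n}"
    then have "y ^ n = y ^ (n - i) * y ^ i" by (simp flip: power_add)
    then show "y ^ n * (of_int (coeff f i) * x ^ i) = of_int (coeff f i) * y ^ (n - i)"
      using y(2) by (simp add: y_def field_simps)
  qed
  also have "\<dots> = of_int (lead_coeff f) + (\<Sum>i<n. of_int (coeff f i) * y ^ (n - i))"
    by (simp add: lessThan_Suc_atMost[symmetric] n_def)
  finally have "of_int (lead_coeff f) = - (\<Sum>i<n. of_int (coeff f i) * y ^ (n - i))"
    by (simp add: eq_neg_iff_add_eq_0)
  moreover have "(\<Sum>i<n. of_int (coeff f i) * y ^ (n - i)) \<in> \<mm>"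
  proof (intro sum_ideal mult_ideal of_int_mem)
    fix i assume "i \<in> {..<n}"
    then obtain k where "n - i = Suc k" by (metis lessThan_iff not0_implies_Suc zero_less_diff less_numeral_extra(3))
    then show "y ^ (n - i) \<in> \<mm>" using y(1) ideal_mem[OF y(1)] by auto
  qed
  ultimately show False using assms(1) by simp
qed

lemma of_int_ideal_iff:
  assumes p: "prime p" "of_nat p \<in> \<mm>"
  shows "of_int b \<in> \<mm> \<longleftrightarrow> int p dvd b"
proof
  assume "int p dvd b"
  then obtain c where "b = int p * c" by blast
  then show "of_int b \<in> \<mm>" using p by auto
next
  assume b: "of_int b \<in> \<mm>"
  show "int p dvd b"
  proof (rule ccontr)
    assume "\<not> int p dvd b"
    then have "coprime (int p) b" using p(1) by (simp add: prime_imp_coprime)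
    then obtain u w where "u * int p + w * b = 1" by (metis bezout_int coprime_iff_gcd_eq_1)
    then have "of_int (u * int p + w * b) = (1::'a)" by simp
    then have "of_int u * of_nat p + of_int w * of_int b = (1::'a)" by simp
    moreover have "of_int u * of_nat p + of_int w * of_int b \<in> \<mm>" using p b by auto
    ultimately show False by simp
  qed
qed

end

locale prime_valuation = valuation_subring A for A :: "'a::field_char_0 set" +
  fixes p :: nat
  assumes prime_p: "prime p" and p_ideal: "of_nat p \<in> \<mm>"
begin

lemma of_int_ideal: "of_int b \<in> \<mm> \<longleftrightarrow> int p dvd b"
  using of_int_ideal_iff prime_p p_ideal .

text \<open>Algebraic integers lie in \<open>A\<close> and \<open>b\<close> is a unit there. So it
  suffices to find leading coefficients outside a single valuation ring above
  \<open>p\<close>.\<close>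

lemma not_p_in_denominator_mem:
  assumes "\<not> p_in_denominator p c" shows "c \<in> A"
proof -
  obtain a b where ab: "alg_integer a" "\<not> int p dvd b" "c = a / of_int b"
    using assms by (auto simp: p_in_denominator_def)
  obtain f :: "int poly" where f: "lead_coeff f = 1" "poly (map_poly of_int f) a = 0"
    using ab(1) unfolding alg_integer_def by blast
  have "a \<in> A" by (rule integral_mem[of f]) (simp_all add: f)
  moreover have "inverse (of_int b) \<in> A"
    using ab(2) by (intro unit_inverse) (auto simp: of_int_ideal)
  ultimately show ?thesis unfolding ab(3) divide_inverse by (rule mult_mem)
qed

end

section \<open>Existence of a valuation ring above p\<close>

definition subring_set :: "'a::field set \<Rightarrow> bool" where
  "subring_set S \<longleftrightarrow> 1 \<in> S \<and> (\<forall>x\<in>S. \<forall>y\<in>S. x - y \<in> S \<and> x * y \<in> S)"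

lemma subring_setD:
  assumes "subring_set S"
  shows "1 \<in> S" "0 \<in> S" "x \<in> S \<Longrightarrow> y \<in> S \<Longrightarrow> x - y \<in> S" "x \<in> S \<Longrightarrow> y \<in> S \<Longrightarrow> x * y \<in> S"
    "x \<in> S \<Longrightarrow> y \<in> S \<Longrightarrow> x + y \<in> S"
proof -
  show 1: "1 \<in> S" "x \<in> S \<Longrightarrow> y \<in> S \<Longrightarrow> x - y \<in> S" "x \<in> S \<Longrightarrow> y \<in> S \<Longrightarrow> x * y \<in> S" for x y
    using assms by (auto simp: subring_set_def)
  show 0: "0 \<in> S" using 1(2)[OF 1(1) 1(1)] by simp
  show "x + y \<in> S" if "x \<in> S" "y \<in> S"
    using 1(2)[OF that(1) 1(2)[OF 0 that(2)]] by simp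
qed

definition polys_over :: "'a::field set \<Rightarrow> 'a poly set" where
  "polys_over S = {f. \<forall>i. coeff f i \<in> S}"

lemma polys_over_simps:
  assumes "subring_set S"
  shows "f \<in> polys_over S \<Longrightarrow> g \<in> polys_over S \<Longrightarrow> f + g \<in> polys_over S"
    and "f \<in> polys_over S \<Longrightarrow> g \<in> polys_over S \<Longrightarrow> f - g \<in> polys_over S"
    and "c \<in> S \<Longrightarrow> g \<in> polys_over S \<Longrightarrow> smult c g \<in> polys_over S"
    and "c \<in> S \<Longrightarrow> monom c n \<in> polys_over S"
    and "f \<in> polys_over S \<Longrightarrow> g \<in> polys_over S \<Longrightarrow> f * g \<in> polys_over S"
proof -
  have sum: "sum h I \<in> S" if "\<And>i. i \<in> I \<Longrightarrow> h i \<in> S" for h :: "nat \<Rightarrow> 'a" and I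
    using that by (induction I rule: infinite_finite_induct) (auto simp: subring_setD[OF assms])
  show "f \<in> polys_over S \<Longrightarrow> g \<in> polys_over S \<Longrightarrow> f * g \<in> polys_over S"
    by (auto simp: polys_over_def coeff_mult intro!: sum subring_setD[OF assms])
qed (auto simp: polys_over_def subring_setD[OF assms])

text \<open>This makes a subring that is maximal among those not containing \<open>c\<inverse>\<close> a valuation ring: if neither \<open>x\<close>
  nor \<open>x\<inverse>\<close> were in it, adjoining either of them would produce \<open>c\<inverse>\<close>.\<close>

lemma no_reciprocal_relations:
  fixes c x :: "'a::field"
  assumes S: "subring_set S" and c: "c \<in> S" "inverse c \<notin> S"
    and f: "f \<in> polys_over S" "c * poly f x = 1"
    and g: "g \<in> polys_over S" "c * poly g (inverse x) = 1"
  shows False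
  using f g
proof (induction "degree f + degree g" arbitrary: f g x rule: less_induct)
  case less
  note ring = subring_setD[OF S] and polys = polys_over_simps[OF S]
  have const: "degree h > 0" if "h \<in> polys_over S" "c * poly h y = 1" for h y
  proof (rule ccontr)
    assume "\<not> degree h > 0"
    then obtain a where "h = [:a:]" by (auto elim: degree_eq_zeroE)
    then have "coeff h 0 = inverse c" using that(2) by (simp add: inverse_unique)
    then show False using that(1) c(2) unfolding polys_over_def mem_Collect_eq by metis
  qed
  have x: "x \<noteq> 0"
  proof
    assume "x = 0"
    then have "coeff f 0 = inverse c" using less.prems(2) by (simp add: poly_0_coeff_0 inverse_unique)
    then show False using less.prems(1) c(2) unfolding polys_over_def mem_Collect_eq by metis
  qed
  \<comment> \<open>The relation of larger degree \<open>n\<close> loses its top term: the other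
    one, multiplied by \<open>y ^ n\<close>, expresses \<open>(1 - c * coeff g 0) * y ^ n\<close> by
    lower powers of \<open>y\<close>.\<close>
  have reduce: "\<exists>f'. f' \<in> polys_over S \<and> c * poly f' y = 1 \<and> degree f' < degree f"
    if f: "f \<in> polys_over S" "c * poly f y = 1" and g: "g \<in> polys_over S" "c * poly g (inverse y) = 1"
      and deg: "degree g \<le> degree f" and y: "y \<noteq> 0" for f g y
  proof -
    define n where "n = degree f"
    define m where "m = degree g"
    define h where "h = (\<Sum>j\<in>{1..m}. monom (coeff g j) (n - j))"
    \<comment> \<open>Multiply the relation for \<open>f\<close> by
      \<open>1 - c * coeff g 0\<close>, rewrite the top power by means of \<open>h\<close>, and add
      \<open>c * coeff g 0\<close> to restore the value 1.\<close>
    define f' where "f' = smult (1 - c * coeff g 0) (f - monom (coeff f n) n)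
      + smult (c * coeff f n) h + monom (coeff g 0) 0"
    have n: "n > 0" using const[OF f] by (simp add: n_def)
    have "h \<in> polys_over S"
      unfolding h_def polys_over_def coeff_sum mem_Collect_eq
    proof
      fix i
      have "(\<Sum>j\<in>J. coeff (monom (coeff g j) (n - j)) i) \<in> S" for J :: "nat set"
        by (induction J rule: infinite_finite_induct)
          (use g(1) in \<open>auto simp: ring polys_over_def\<close>)
      then show "(\<Sum>j = 1..m. coeff (monom (coeff g j) (n - j)) i) \<in> S" .
    qed
    then have "f' \<in> polys_over S"
      unfolding f'_def using f g c by (intro polys ring) (auto simp: polys_over_def)
    moreover have "degree f' < degree f"
    proof -
      have "coeff f' i = 0" if "i \<ge> n" for i
      proof -
        have "coeff h i = 0" unfolding h_def coeff_sum using that n by (intro sum.neutral) auto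
        then show ?thesis using that n by (auto simp: f'_def n_def coeff_eq_0)
      qed
      then have "degree f' \<le> n - 1" using n by (intro degree_le) auto
      then show ?thesis using n by (simp add: n_def)
    qed
    moreover have "c * poly f' y = 1"
    proof -
      have h: "(1 - c * coeff g 0) * y ^ n = c * poly h y"
      proof -
        have "poly g (inverse y) * y ^ n = (\<Sum>j\<le>m. coeff g j * y ^ (n - j))"
          unfolding poly_altdef m_def sum_distrib_right
        proof (intro sum.cong refl)
          fix j assume "j \<in> {..degree g}"
          then have "y ^ n = y ^ (n - j) * y ^ j" using deg by (simp add: n_def flip: power_add)
          then show "coeff g j * inverse y ^ j * y ^ n = coeff g j * y ^ (n - j)"
            using y by (simp add: field_simps)
        qed
        also have "{..m} = insert 0 {1..m}" by auto
        finally have "poly g (inverse y) * y ^ n = coeff g 0 * y ^ n + poly h y"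
          by (simp add: h_def poly_sum poly_monom)
        then have "c * poly g (inverse y) * y ^ n = c * coeff g 0 * y ^ n + c * poly h y"
          by (simp add: algebra_simps)
        then show ?thesis using g by (simp add: algebra_simps)
      qed
      have "c * poly f' y = (1 - c * coeff g 0) * (c * poly f y) - c * coeff f n * ((1 - c * coeff g 0) * y ^ n)
          + c * coeff f n * (c * poly h y) + c * coeff g 0"
        by (simp add: f'_def poly_monom algebra_simps)
      then show ?thesis unfolding h f(2) by simp
    qed
    ultimately show ?thesis by blast
  qed
  show False
  proof (cases "degree g \<le> degree f")
    case True
    then obtain f' where "f' \<in> polys_over S" "c * poly f' x = 1" "degree f' < degree f"
      using reduce less.prems x by blast
    then show False using less.hyps[of f' g x] less.prems by auto
  next
    case False
    then obtain g' where "g' \<in> polys_over S" "c * poly g' (inverse x) = 1" "degree g' < degree g"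
      using reduce[of g "inverse x" f] less.prems x by auto
    then show False using less.hyps[of f g' x] less.prems by auto
  qed
qed

text \<open>Zorn's lemma gives a maximal subring without the inverse of \<open>p\<close>. The
  preceding lemma with \<open>c = of_nat p\<close> makes it a valuation ring, in which
  \<open>p\<close> is not a unit.\<close>

lemma exists_prime_valuation:
  assumes "prime p"
  shows "\<exists>A::'a::field_char_0 set. prime_valuation A p"
proof -
  define \<A> where "\<A> = {S::'a set. subring_set S \<and> inverse (of_nat p) \<notin> S}"
  have Z: "range of_int \<in> \<A>"
  proof -
    have "inverse (of_nat p) \<noteq> (of_int k :: 'a)" for k
    proof
      assume "inverse (of_nat p) = (of_int k :: 'a)"
      then have "(of_int (int p * k) :: 'a) = of_int 1" using assms by (auto simp: field_simps)
      then have "int p * k = 1" by (simp only: of_int_eq_iff)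
      then show False using assms
        by (metis int_dvd_int_iff dvd_triv_left int_ops(2) nat_dvd_1_iff_1 not_prime_1)
    qed
    moreover have "subring_set (range of_int :: 'a set)"
      unfolding subring_set_def by (auto simp flip: of_int_diff of_int_mult intro: range_eqI[of _ _ 1])
    ultimately show ?thesis by (auto simp: \<A>_def)
  qed
  have "\<exists>M\<in>\<A>. \<forall>X\<in>\<A>. M \<subseteq> X \<longrightarrow> X = M"
  proof (rule subset_Zorn_nonempty)
    show "\<A> \<noteq> {}" using Z by blast
    fix C assume C: "C \<noteq> {}" "subset.chain \<A> C"
    have sub: "S \<in> \<A>" if "S \<in> C" for S using C that by (auto simp: subset.chain_def)
    have "subring_set (\<Union>C)"
      unfolding subring_set_def
    proof (intro conjI ballI)
      show "1 \<in> \<Union>C" using C sub by (fastforce simp: \<A>_def subring_set_def)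
      fix x y assume "x \<in> \<Union>C" "y \<in> \<Union>C"
      then obtain S T where ST: "S \<in> C" "T \<in> C" "x \<in> S" "y \<in> T" by blast
      then have "S \<subseteq> T \<or> T \<subseteq> S" using C(2) by (auto simp: subset_chain_def)
      then obtain R where "R \<in> C" "x \<in> R" "y \<in> R" using ST by blast
      then show "x - y \<in> \<Union>C" "x * y \<in> \<Union>C" using sub[of R] by (auto simp: \<A>_def subring_set_def)
    qed
    then show "\<Union>C \<in> \<A>" using sub by (auto simp: \<A>_def)
  qed
  then obtain A where A: "A \<in> \<A>" and max: "\<And>X. X \<in> \<A> \<Longrightarrow> A \<subseteq> X \<Longrightarrow> X = A" by blast
  have S: "subring_set A" "inverse (of_nat p) \<notin> A" using A by (auto simp: \<A>_def)
  note ring = subring_setD[OF S(1)]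
  have p: "of_nat p \<in> A"
  proof -
    have "of_nat n \<in> A" for n by (induction n) (auto intro: ring)
    then show ?thesis .
  qed
  \<comment> \<open>The ring \<open>A[x]\<close> is strictly larger than \<open>A\<close>, so by
    maximality it contains the inverse of \<open>p\<close>.\<close>
  have adjoin: "\<exists>f\<in>polys_over A. of_nat p * poly f x = 1" if x: "x \<notin> A" for x
  proof -
    define T where "T = (\<lambda>f. poly f x) ` polys_over A"
    have "A \<subseteq> T"
    proof
      fix a assume "a \<in> A"
      then have "[:a:] \<in> polys_over A" by (auto simp: polys_over_def coeff_pCons ring split: nat.splits)
      then show "a \<in> T" unfolding T_def by (force intro: image_eqI[of _ _ "[:a:]"])
    qed
    moreover have "x \<in> T"
      unfolding T_def by (rule image_eqI[of _ _ "[:0, 1:]"])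
        (auto simp: polys_over_def coeff_pCons ring split: nat.splits)
    moreover have "subring_set T"
      unfolding subring_set_def
    proof (intro conjI ballI)
      show "1 \<in> T" using \<open>A \<subseteq> T\<close> ring by blast
      fix u v assume "u \<in> T" "v \<in> T"
      then obtain f g where fg: "f \<in> polys_over A" "g \<in> polys_over A" "u = poly f x" "v = poly g x"
        by (auto simp: T_def)
      show "u - v \<in> T" unfolding T_def
        by (rule image_eqI[of _ _ "f - g"]) (use fg polys_over_simps[OF S(1)] in auto)
      show "u * v \<in> T" unfolding T_def
        by (rule image_eqI[of _ _ "f * g"]) (use fg polys_over_simps[OF S(1)] in auto)
    qed
    ultimately have "inverse (of_nat p) \<in> T" using max[of T] x by (auto simp: \<A>_def)
    then obtain f where "f \<in> polys_over A" "poly f x = inverse (of_nat p)" by (auto simp: T_def)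
    then show ?thesis using assms by (intro bexI[of _ f]) auto
  qed
  interpret valuation_subring A
  proof
    fix x
    show "x \<in> A \<or> inverse x \<in> A"
      using adjoin[of x] adjoin[of "inverse x"] no_reciprocal_relations[OF S(1) p S(2)] by blast
  qed (auto intro: ring)
  have "of_nat p \<in> \<mm>" using p S(2) by (simp add: \<mm>_def)
  then have "prime_valuation A p" by unfold_locales (use assms in auto)
  then show ?thesis by blast
qed

section \<open>Integer relations in a number field\<close>

lemma common_denominator:
  fixes u :: "'b \<Rightarrow> rat"
  assumes "finite S"
  shows "\<exists>N::int. N \<noteq> 0 \<and> (\<forall>v\<in>S. \<exists>k::int. of_int N * u v = of_int k)"
  using assms
proof (induction S rule: finite_induct)
  case (insert x S)
  then obtain N :: int where N: "N \<noteq> 0" "\<forall>v\<in>S. \<exists>k::int. of_int N * u v = of_int k" by blast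
  obtain a b :: int where ab: "u x = of_int a / of_int b" "b \<noteq> 0"
    by (metis Rat_cases Fract_of_int_quotient less_irrefl)
  have "\<exists>k::int. of_int (N * b) * u v = of_int k" if "v \<in> insert x S" for v
  proof (cases "v = x")
    case True
    then show ?thesis using ab by (intro exI[of _ "N * a"]) simp
  next
    case False
    then have "v \<in> S" using that by simp
    from bspec[OF N(2) this] obtain k :: int where "of_int N * u v = of_int k" by blast
    then have "of_int (N * b) * u v = of_int (b * k)"
      by (metis (no_types, lifting) mult.assoc mult.commute of_int_mult)
    then show ?thesis by (rule exI)
  qed
  then show ?case using N(1) ab(2) by (intro exI[of _ "N * b"]) auto
qed (simp add: exI[of _ 1])

text \<open>More than \<open>card B\<close> elements are dependent over the rationals, and
  denominators can be cleared. The bound serves both for the powers of one element and for the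
  residue degree.\<close>

lemma number_field_int_relation:
  assumes "number_field TYPE('a::field_char_0)"
  obtains n where "\<And>S::'a set. finite S \<Longrightarrow> card S > n \<Longrightarrow>
    \<exists>c::'a \<Rightarrow> int. (\<exists>v\<in>S. c v \<noteq> 0) \<and> (\<Sum>v\<in>S. of_int (c v) * v) = 0"
proof -
  interpret rat_vs: vector_space "\<lambda>(q::rat) (x::'a). of_rat q * x"
    by unfold_locales (auto simp: algebra_simps of_rat_add of_rat_mult)
  obtain B :: "'a set" where B: "finite B" "\<And>x. \<exists>c. x = (\<Sum>b\<in>B. of_rat (c b) * b)"
    using assms unfolding number_field_def by blast
  have span: "x \<in> rat_vs.span B" for x
  proof -
    obtain c where "x = (\<Sum>b\<in>B. of_rat (c b) * b)" using B(2) by blast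
    moreover have "\<dots> \<in> rat_vs.span B"
      by (intro rat_vs.span_sum rat_vs.span_scale rat_vs.span_base)
    ultimately show ?thesis by (simp only:)
  qed
  have "\<exists>c::'a \<Rightarrow> int. (\<exists>v\<in>S. c v \<noteq> 0) \<and> (\<Sum>v\<in>S. of_int (c v) * v) = 0"
    if S: "finite S" "card S > card B" for S
  proof -
    have "rat_vs.dependent S"
      using rat_vs.independent_span_bound[OF B(1), of S] span S by force
    then obtain u where u: "\<exists>v\<in>S. u v \<noteq> 0" "(\<Sum>v\<in>S. of_rat (u v) * v) = 0"
      using rat_vs.dependent_finite[OF S(1)] by blast
    obtain N :: int where N: "N \<noteq> 0" "\<forall>v\<in>S. \<exists>k::int. of_int N * u v = of_int k"
      using common_denominator[OF S(1)] by blast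
    obtain c :: "'a \<Rightarrow> int" where c: "\<And>v. v \<in> S \<Longrightarrow> of_int N * u v = of_int (c v)"
      using N(2) by metis
    have "(\<Sum>v\<in>S. of_int (c v) * v) = of_int N * (\<Sum>v\<in>S. of_rat (u v) * v)"
      unfolding sum_distrib_left
    proof (intro sum.cong refl)
      fix v assume "v \<in> S"
      then have "(of_rat (of_int (c v)) :: 'a) = of_rat (of_int N * u v)" using c by simp
      then show "of_int (c v) * v = of_int N * (of_rat (u v) * v)" by (simp add: of_rat_mult)
    qed
    moreover have "\<exists>v\<in>S. c v \<noteq> 0"
    proof -
      obtain v where v: "v \<in> S" "u v \<noteq> 0" using u(1) by blast
      then have "of_int (c v) \<noteq> (0::rat)" using c[OF v(1)] N(1) by (metis mult_eq_0_iff of_int_eq_0_iff)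
      then show ?thesis using v(1) by auto
    qed
    ultimately show ?thesis using u(2) by auto
  qed
  then show thesis by (rule that)
qed

lemma number_field_algebraic:
  assumes "number_field TYPE('a::field_char_0)"
  shows "\<exists>f::int poly. f \<noteq> 0 \<and> poly (map_poly of_int f) (x::'a) = 0"
proof -
  obtain n where n: "\<And>S::'a set. finite S \<Longrightarrow> card S > n \<Longrightarrow>
    \<exists>c::'a \<Rightarrow> int. (\<exists>v\<in>S. c v \<noteq> 0) \<and> (\<Sum>v\<in>S. of_int (c v) * v) = 0"
    using number_field_int_relation[OF assms] by blast
  show ?thesis
  proof (cases "inj_on (\<lambda>i. x ^ i) {..n}")
    case True
    then obtain c :: "'a \<Rightarrow> int" where c: "\<exists>v\<in>(\<lambda>i. x ^ i) ` {..n}. c v \<noteq> 0"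
        "(\<Sum>v\<in>(\<lambda>i. x ^ i) ` {..n}. of_int (c v) * v) = 0"
      using n[of "(\<lambda>i. x ^ i) ` {..n}"] by (auto simp: card_image)
    define f where "f = (\<Sum>i\<le>n. monom (c (x ^ i)) i)"
    have cf: "coeff f i = (if i \<le> n then c (x ^ i) else 0)" for i
      by (simp add: f_def coeff_sum if_distrib sum.delta cong: if_cong)
    then have "degree f \<le> n" by (intro degree_le) auto
    then have "poly (map_poly of_int f) x = (\<Sum>i\<le>n. of_int (c (x ^ i)) * x ^ i)"
      by (simp add: poly_map_of_int_altdef cf)
    also have "\<dots> = 0" using c(2) True by (simp add: sum.reindex)
    finally show ?thesis using c(1) cf by (intro exI[of _ f]) (auto simp: poly_eq_iff)
  next
    \<comment> \<open>Relations are indexed by sets, so coinciding powers need their own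
      polynomial.\<close>
    case False
    then obtain i j where ij: "i < j" "x ^ i = x ^ j"
      unfolding inj_on_def by (metis linorder_neqE_nat)
    define f :: "int poly" where "f = monom 1 j - monom 1 i"
    have "coeff f j = 1" using ij by (simp add: f_def)
    then have "f \<noteq> 0" by auto
    moreover have "poly (map_poly of_int f) x = 0"
    proof -
      have "map_poly of_int f = (monom 1 j - monom 1 i :: 'a poly)"
        by (rule poly_eqI) (simp add: f_def coeff_map_poly)
      then show ?thesis using ij by (simp add: poly_monom)
    qed
    ultimately show ?thesis by blast
  qed
qed

text \<open>If \<open>x\<close> is not in \<open>A\<close>, then \<open>p\<close> divides the
  leading coefficient of any integer polynomial vanishing at \<open>x\<close>. The polynomial is
  chosen before \<open>A\<close>, so all valuation rings above \<open>p\<close> are treated at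
  once.\<close>

lemma number_field_almost_all_mem:
  assumes "number_field TYPE('a::field_char_0)" "finite (X::'a set)"
  shows "finite {p. \<exists>A. prime_valuation A p \<and> \<not> X \<subseteq> A}"
proof -
  obtain f :: "'a \<Rightarrow> int poly" where f: "\<And>x. f x \<noteq> 0" "\<And>x. poly (map_poly of_int (f x)) x = 0"
    using number_field_algebraic[OF assms(1)] by metis
  have "{p. \<exists>A. prime_valuation A p \<and> \<not> X \<subseteq> A} \<subseteq> (\<Union>x\<in>X. {p. int p dvd lead_coeff (f x)})"
  proof
    fix p assume "p \<in> {p. \<exists>A. prime_valuation A p \<and> \<not> X \<subseteq> A}"
    then obtain A x where A: "prime_valuation A p" "x \<in> X" "x \<notin> A" by blast
    interpret prime_valuation A p by fact
    have "of_int (lead_coeff (f x)) \<in> \<mm>" using integral_mem[of "f x" x] f A by blast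
    then show "p \<in> (\<Union>x\<in>X. {p. int p dvd lead_coeff (f x)})" using A by (auto simp: of_int_ideal)
  qed
  moreover have "finite {p. int p dvd b}" if "b \<noteq> 0" for b :: int
  proof (rule finite_subset)
    show "{p. int p dvd b} \<subseteq> {..nat \<bar>b\<bar>}"
      using that dvd_imp_le_int[of b] by (force simp: nat_le_eq_zle)
  qed auto
  ultimately show ?thesis using assms(2) f(1)
    by (meson finite_UN_I finite_subset leading_coeff_0_iff)
qed

section \<open>Finiteness of the residue field\<close>

context prime_valuation
begin

text \<open>Linear independence of the residues over the field with \<open>p\<close> elements,
  written with integer coefficients.\<close>

definition indep_mod :: "'a set \<Rightarrow> bool" where
  "indep_mod S \<longleftrightarrow> (\<forall>c::'a \<Rightarrow> int. (\<Sum>v\<in>S. of_int (c v) * v) \<in> \<mm> \<longrightarrow> (\<forall>v\<in>S. int p dvd c v))"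

text \<open>Infinite descent: all coefficients of a relation are divisible by \<open>p\<close>, and
  dividing by \<open>p\<close> gives a smaller relation. Together with
  \<open>number_field_int_relation\<close> this bounds the size of independent sets.\<close>

lemma indep_mod_no_relation:
  assumes S: "finite S" "indep_mod S" and c: "(\<Sum>v\<in>S. of_int (c v) * v) = 0" and v: "v \<in> S"
  shows "c v = (0::int)"
  using c v
proof (induction "\<Sum>v\<in>S. nat \<bar>c v\<bar>" arbitrary: c v rule: less_induct)
  case less
  have "\<forall>v\<in>S. int p dvd c v"
    using S(2) less.prems(1) unfolding indep_mod_def by (metis zero_ideal)
  then have "\<forall>v\<in>S. \<exists>k. c v = int p * k" by (simp add: dvd_def)
  then obtain e where e: "\<And>v. v \<in> S \<Longrightarrow> c v = int p * e v" by metis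
  have p: "p > 1" using prime_p prime_gt_1_nat by blast
  have "of_nat p * (\<Sum>v\<in>S. of_int (e v) * v) = (\<Sum>v\<in>S. of_int (c v) * v)"
    unfolding sum_distrib_left by (intro sum.cong) (auto simp: e)
  then have rel: "(\<Sum>v\<in>S. of_int (e v) * v) = 0" using less.prems p by simp
  show ?case
  proof (rule ccontr)
    assume nz: "c v \<noteq> 0"
    have "(\<Sum>v\<in>S. nat \<bar>e v\<bar>) < (\<Sum>v\<in>S. nat \<bar>c v\<bar>)"
    proof (rule sum_strict_mono_ex1[OF S(1)])
      have "\<bar>e v\<bar> * 1 \<le> \<bar>e v\<bar> * int p" for v using p by (intro mult_left_mono) auto
      then show "\<forall>v\<in>S. nat \<bar>e v\<bar> \<le> nat \<bar>c v\<bar>"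
        using e by (auto simp: abs_mult mult.commute intro!: nat_mono)
      have "e v \<noteq> 0" using nz e[OF less.prems(2)] by auto
      then have "\<bar>e v\<bar> * 1 < \<bar>e v\<bar> * int p" using p by (intro mult_strict_left_mono) auto
      then show "\<exists>v\<in>S. nat \<bar>e v\<bar> < nat \<bar>c v\<bar>"
        using e less.prems(2) by (intro bexI[of _ v]) (auto simp: abs_mult mult.commute)
    qed
    then have "e v = 0" using less.hyps rel less.prems(2) by blast
    then show False using nz e[OF less.prems(2)] by simp
  qed
qed

text \<open>A largest set that is independent modulo \<mm> spans the residue field, so its
  combinations with coefficients from 0 to \<open>p - 1\<close> meet every residue class.\<close>

lemma finite_residues:
  assumes "number_field TYPE('a)"
  obtains R where "finite R" "\<And>x. x \<in> A \<Longrightarrow> \<exists>r\<in>R. x - r \<in> \<mm>" "R \<subseteq> A"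
proof -
  obtain n where n: "\<And>S::'a set. finite S \<Longrightarrow> card S > n \<Longrightarrow>
    \<exists>c::'a \<Rightarrow> int. (\<exists>v\<in>S. c v \<noteq> 0) \<and> (\<Sum>v\<in>S. of_int (c v) * v) = 0"
    using number_field_int_relation[OF assms] by blast
  define P where "P k \<longleftrightarrow> (\<exists>S\<subseteq>A. finite S \<and> indep_mod S \<and> card S = k)" for k
  have bound: "k \<le> n" if Pk: "P k" for k
  proof (rule ccontr)
    assume "\<not> k \<le> n"
    then obtain S where S: "finite S" "indep_mod S" "card S > n" using Pk by (auto simp: P_def)
    then show False using n[of S] indep_mod_no_relation[OF S(1,2)] by blast
  qed
  have "P 0" unfolding P_def by (rule exI[of _ "{}"]) (auto simp: indep_mod_def)
  have "P (Greatest P)" using GreatestI_nat[of P 0 n] \<open>P 0\<close> bound by blast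
  then obtain S where S: "S \<subseteq> A" "finite S" "indep_mod S" "card S = Greatest P" by (auto simp: P_def)
  define R where "R = (\<lambda>e. \<Sum>v\<in>S. of_int (e v) * v) ` (S \<rightarrow>\<^sub>E {0..<int p})"
  have p0: "int p > 0" using prime_p prime_gt_0_nat by simp
  have sumA: "(\<Sum>v\<in>S. of_int (e v) * v) \<in> A" for e using S(1) by auto
  have "\<exists>r\<in>R. x - r \<in> \<mm>" if x: "x \<in> A" for x
  proof -
    have "\<exists>e. x - (\<Sum>v\<in>S. of_int (e v) * v) \<in> \<mm>"
    proof (cases "x \<in> S")
      case True
      have "(\<Sum>v\<in>S. of_int (if v = x then 1 else 0) * v) = x"
        using S(2) True by (simp add: if_distrib[of of_int] if_distrib[of "\<lambda>t. t * _"] sum.delta cong: if_cong)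
      then show ?thesis by (intro exI[of _ "\<lambda>v. if v = x then 1 else 0"]) simp
    next
      case False
      have "\<not> indep_mod (insert x S)"
      proof
        assume "indep_mod (insert x S)"
        then have "P (Suc (card S))" unfolding P_def using S x False by (intro exI[of _ "insert x S"]) auto
        then show False using Greatest_le_nat[of P "Suc (card S)" n] bound S(4) by force
      qed
      then obtain c :: "'a \<Rightarrow> int" where c: "of_int (c x) * x + (\<Sum>v\<in>S. of_int (c v) * v) \<in> \<mm>"
          "\<exists>v\<in>insert x S. \<not> int p dvd c v"
        unfolding indep_mod_def using False S(2) by auto
      have "\<not> int p dvd c x"
      proof
        assume "int p dvd c x"
        then have "of_int (c x) * x \<in> \<mm>" using x by (intro mult_ideal') (auto simp: of_int_ideal)
        then have "(\<Sum>v\<in>S. of_int (c v) * v) \<in> \<mm>" using diff_ideal[OF c(1)] by fastforce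
        then show False using S(3) c(2) \<open>int p dvd c x\<close> by (auto simp: indep_mod_def)
      qed
      then have "coprime (int p) (c x)" using prime_p by (simp add: prime_imp_coprime)
      \<comment> \<open>\<open>w\<close> inverts the coefficient of \<open>x\<close> modulo
        \<open>p\<close>, which solves the relation for \<open>x\<close>.\<close>
      then obtain u w where uw: "u * int p + w * c x = 1" by (metis bezout_int coprime_iff_gcd_eq_1)
      have "of_int (u * int p + w * c x) = (1::'a)" using uw by simp
      then have "x = of_int (u * int p + w * c x) * x" by simp
      then have "x - (\<Sum>v\<in>S. of_int (- (w * c v)) * v)
          = of_int w * (of_int (c x) * x + (\<Sum>v\<in>S. of_int (c v) * v)) + of_int u * of_nat p * x"
        by (simp add: sum_distrib_left sum_negf algebra_simps)
      moreover have "\<dots> \<in> \<mm>" using c(1) p_ideal x by (metis add_ideal mult_ideal mult_ideal' of_int_mem)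
      ultimately show ?thesis by (intro exI[of _ "\<lambda>v. - (w * c v)"]) simp
    qed
    then obtain e where e: "x - (\<Sum>v\<in>S. of_int (e v) * v) \<in> \<mm>" by blast
    define e' where "e' = (\<lambda>v\<in>S. e v mod int p)"
    have "(\<Sum>v\<in>S. of_int (e v) * v) - (\<Sum>v\<in>S. of_int (e' v) * v) = (\<Sum>v\<in>S. of_int (e v - e' v) * v)"
      by (simp add: sum_subtractf algebra_simps)
    also have "\<dots> \<in> \<mm>"
      using S(1) by (intro sum_ideal mult_ideal') (auto simp: of_int_ideal e'_def simp del: of_int_diff)
    finally have "x - (\<Sum>v\<in>S. of_int (e' v) * v) \<in> \<mm>" using add_ideal[OF e] by fastforce
    moreover have "e' \<in> S \<rightarrow>\<^sub>E {0..<int p}" using p0 by (auto simp: e'_def)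
    ultimately show ?thesis by (auto simp: R_def)
  qed
  moreover have "finite R" unfolding R_def using S(2) by (intro finite_imageI finite_PiE) auto
  moreover have "R \<subseteq> A" using sumA by (auto simp: R_def)
  ultimately show thesis using that by blast
qed

end

subsection \<open>Continued fractions of Laurent series\<close>

lemma coeff_lser_floor: "coeff (lser_floor \<alpha>) i = \<alpha> $$ (- int i)"
proof -
  have "coeff (lser_floor \<alpha>) i = (\<Sum>j\<le>nat (- lser_ord \<alpha>). if j = i then \<alpha> $$ (- int j) else 0)"
    unfolding lser_floor_def coeff_sum by (intro sum.cong) auto
  also have "\<dots> = \<alpha> $$ (- int i)"
    by (auto simp: lser_ord_def)
  finally show ?thesis .
qed

lemma lser_frac_nth: "(\<alpha> - poly_to_lser (lser_floor \<alpha>)) $$ n = (if n \<le> 0 then 0 else \<alpha> $$ n)"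
  by (simp add: poly_to_lser_nth coeff_lser_floor)

lemma (in valuation_subring) floor_\<O>: "s \<in> \<O> \<Longrightarrow> poly_to_lser (lser_floor s) \<in> \<O>"
  by (simp add: \<O>_poly_iff coeff_lser_floor \<O>_nth)

text \<open>Descent: if \<open>P = s Q\<close> modulo \<open>\<mm>\<close> and \<open>F = \<lfloor>s\<rfloor>\<close>, then \<open>(D Q - F P, P - F Q)\<close> is another such pair,
  and \<open>P - F Q = (s - F) Q\<close> has smaller degree than \<open>Q\<close>.\<close>

lemma (in valuation_subring) sqrt_irrational_mod:
  assumes s: "s \<in> \<O>" "s\<^sup>2 = poly_to_lser D" "s - poly_to_lser (lser_floor s) \<notin> \<M>"
    and PQ: "poly_to_lser P \<in> \<O>" "poly_to_lser Q \<in> \<O>" "poly_to_lser P - s * poly_to_lser Q \<in> \<M>"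
  shows "poly_to_lser Q \<in> \<M>"
proof -
  let ?L = poly_to_lser and ?F = "lser_floor s"
  have F: "?L ?F \<in> \<O>" using s(1) by (rule floor_\<O>)
  have D: "?L D \<in> \<O>" using s(1) unfolding s(2)[symmetric] by auto
  have frac: "s - ?L ?F \<in> \<O>" "vanishes_below (s - ?L ?F) 1"
    using s F by (auto simp: vanishes_below_def lser_frac_nth simp del: fls_minus_nth)
  \<comment> \<open>The bound says that the reduction of \<open>Q\<close> has degree less than
    \<open>b\<close>.\<close>
  have "?L Q \<in> \<M>" if "vanishes_below (?L Q) (1 - int b)" for b
    using PQ that
  proof (induction b arbitrary: P Q)
    case 0
    then show ?case by (intro vanishes_below_1_poly) simp
  next
    case (Suc b)
    let ?Q = "P - ?F * Q" and ?P = "D * Q - ?F * P"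
    have err: "?L ?P - s * ?L ?Q = - (s + ?L ?F) * (?L P - s * ?L Q)"
      by (simp add: s(2)[symmetric] power2_eq_square algebra_simps)
    have Q: "?L ?Q = (?L P - s * ?L Q) + (s - ?L ?F) * ?L Q"
      by (simp add: algebra_simps)
    have "?L ?Q \<in> \<M>"
    proof (rule Suc.IH)
      show "?L ?P - s * ?L ?Q \<in> \<M>"
        unfolding err using Suc.prems s(1) F by auto
      have "vanishes_below ((s - ?L ?F) * ?L Q) (1 + (1 - int (Suc b)))"
        using vanishes_below_mult[OF frac Suc.prems(2,4)] .
      moreover have "vanishes_below (?L P - s * ?L Q) (1 + (1 - int (Suc b)))"
        using \<M>_nth[OF Suc.prems(3)] by (simp add: vanishes_below_def)
      ultimately show "vanishes_below (?L ?Q) (1 - int b)"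
        using vanishes_below_add unfolding Q by fastforce
    qed (use Suc.prems D F in auto)
    then have "(s - ?L ?F) * ?L Q \<in> \<M>" using Suc.prems(3) \<M>_diff Q by fastforce
    then show ?case using prime_\<M>[OF frac(1) Suc.prems(2)] s(3) by blast
  qed
  moreover have "vanishes_below (?L Q) (1 - int (Suc (degree Q)))"
    using vanishes_below_subdegree[of "?L Q"] by simp
  ultimately show ?thesis by blast
qed

primrec cf_pair :: "'a::field fls \<Rightarrow> nat \<Rightarrow> ('a poly \<times> 'a poly) \<times> ('a poly \<times> 'a poly)" where
  "cf_pair s 0 = ((0, 1), (1, 0))"
| "cf_pair s (Suc n) = (case cf_pair s n of ((p', q'), (p, q)) \<Rightarrow>
     ((p, q), (cf_partial s n * p + p', cf_partial s n * q + q')))"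

text \<open>The index is shifted by one against the usual convention: \<open>cf_num s (Suc n)\<close> and
  \<open>cf_den s (Suc n)\<close> belong to the convergent \<open>[a\<^sub>0, \<dots>, a\<^sub>n]\<close>.\<close>

definition cf_num :: "'a::field fls \<Rightarrow> nat \<Rightarrow> 'a poly" where
  "cf_num s n = fst (snd (cf_pair s n))"

definition cf_den :: "'a::field fls \<Rightarrow> nat \<Rightarrow> 'a poly" where
  "cf_den s n = snd (snd (cf_pair s n))"

lemma cf_num_den_simps:
  "cf_num s 0 = 1" "cf_den s 0 = 0"
  "cf_num s (Suc 0) = cf_partial s 0" "cf_den s (Suc 0) = 1"
  "cf_num s (Suc (Suc n)) = cf_partial s (Suc n) * cf_num s (Suc n) + cf_num s n"
  "cf_den s (Suc (Suc n)) = cf_partial s (Suc n) * cf_den s (Suc n) + cf_den s n"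
  by (simp_all add: cf_num_def cf_den_def split: prod.splits)

definition cf_err :: "'a::field fls \<Rightarrow> nat \<Rightarrow> 'a fls" where
  "cf_err s n = poly_to_lser (cf_num s n) - s * poly_to_lser (cf_den s n)"

lemma cf_det: "cf_num s n * cf_den s (Suc n) - cf_num s (Suc n) * cf_den s n = (- 1) ^ n"
  by (induction n) (simp_all add: cf_num_den_simps algebra_simps)

locale irrational_series =
  fixes s :: "'a::field fls"
  assumes irrational: "poly_to_lser P = s * poly_to_lser Q \<Longrightarrow> Q = 0"
begin

lemma cf_err_nonzero: "cf_err s n \<noteq> 0"
proof
  assume "cf_err s n = 0"
  then have *: "poly_to_lser (cf_num s n) = s * poly_to_lser (cf_den s n)"
    by (simp add: cf_err_def)
  then have "cf_den s n = 0" by (rule irrational)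
  moreover from this * have "cf_num s n = 0" by simp
  ultimately have "(- 1) ^ n = (0 :: 'a poly)" using cf_det[of s n] by simp
  then show False by simp
qed

text \<open>The errors obey the recurrence of the convergents, and consecutive errors have quotient
  \<open>- cf_complete s (Suc n)\<close>. This carries orders and leading coefficients of complete
  quotients over to the errors.\<close>

lemma cf_err_Suc:
  "cf_err s (Suc n) = - cf_err s n * (cf_complete s n - poly_to_lser (cf_partial s n))"
proof (induction n)
  case 0
  then show ?case by (simp add: cf_err_def cf_num_den_simps)
next
  case (Suc n)
  have "cf_complete s (Suc n) = inverse (cf_complete s n - poly_to_lser (cf_partial s n))"
    by (simp add: cf_partial_def)
  moreover have "cf_complete s n - poly_to_lser (cf_partial s n) \<noteq> 0"
    using Suc cf_err_nonzero[of "Suc n"] by auto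
  ultimately have "cf_err s n = - cf_complete s (Suc n) * cf_err s (Suc n)"
    unfolding Suc by (simp add: field_simps)
  moreover have "cf_err s (Suc (Suc n)) = poly_to_lser (cf_partial s (Suc n)) * cf_err s (Suc n) + cf_err s n"
    by (simp add: cf_err_def cf_num_den_simps algebra_simps)
  ultimately show ?case by (simp add: algebra_simps del: cf_complete.simps)
qed

text \<open>The expansion never terminates, so the default value \<open>inverse 0 = 0\<close> never
  enters \<open>cf_complete\<close>.\<close>

lemma cf_frac_nonzero: "cf_complete s n - poly_to_lser (cf_partial s n) \<noteq> 0"
  using cf_err_Suc[of n] cf_err_nonzero[of "Suc n"] by auto

lemma cf_err_eq: "cf_err s n = - cf_complete s (Suc n) * cf_err s (Suc n)"
  using cf_frac_nonzero[of n] unfolding cf_err_Suc by (simp add: field_simps cf_partial_def)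

lemma subdegree_cf_complete: "fls_subdegree (cf_complete s (Suc n)) < 0"
proof -
  have "fls_subdegree (cf_complete s n - poly_to_lser (cf_partial s n)) \<ge> 1"
    using cf_frac_nonzero[of n]
    by (intro fls_subdegree_geI) (simp_all only: cf_partial_def lser_frac_nth, auto)
  then show ?thesis by (simp add: cf_partial_def)
qed

lemma degree_cf_partial: "int (degree (cf_partial s (Suc n))) = - fls_subdegree (cf_complete s (Suc n))"
  and lead_coeff_cf_partial:
    "lead_coeff (cf_partial s (Suc n)) = cf_complete s (Suc n) $$ fls_subdegree (cf_complete s (Suc n))"
proof -
  let ?a = "cf_complete s (Suc n)"
  define k where "k = nat (- fls_subdegree ?a)"
  have k: "int k = - fls_subdegree ?a" using subdegree_cf_complete[of n] by (simp add: k_def)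
  have "?a \<noteq> 0" using subdegree_cf_complete[of n] by force
  then have "?a $$ (- int k) \<noteq> 0" using k nth_fls_subdegree_nonzero[of ?a] by simp
  moreover have "?a $$ (- int i) = 0" if "i > k" for i
    using that k by (intro fls_eq0_below_subdegree) simp
  ultimately have "degree (cf_partial s (Suc n)) = k"
    unfolding cf_partial_def
    by (intro antisym degree_le le_degree) (auto simp: coeff_lser_floor simp del: cf_complete.simps)
  then show "int (degree (cf_partial s (Suc n))) = - fls_subdegree ?a"
    and "lead_coeff (cf_partial s (Suc n)) = ?a $$ fls_subdegree ?a"
    using k by (simp_all add: cf_partial_def coeff_lser_floor del: cf_complete.simps)
qed

lemma degree_cf_partial_pos: "degree (cf_partial s (Suc n)) > 0"
  using degree_cf_partial[of n] subdegree_cf_complete[of n] by linarith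

text \<open>The claims share one induction because the degree bound on the preceding denominator
  excludes cancellation of the top term in the recurrence.\<close>

lemma cf_den_step:
  "cf_den s (Suc n) \<noteq> 0 \<and> degree (cf_den s n) \<le> degree (cf_den s (Suc n)) \<and>
   degree (cf_den s (Suc (Suc n))) = degree (cf_partial s (Suc n)) + degree (cf_den s (Suc n)) \<and>
   lead_coeff (cf_den s (Suc (Suc n))) = lead_coeff (cf_partial s (Suc n)) * lead_coeff (cf_den s (Suc n))"
proof (induction n)
  case 0
  then show ?case by (simp add: cf_num_den_simps)
next
  case (Suc n)
  have a: "cf_partial s (Suc k) \<noteq> 0" for k using degree_cf_partial_pos[of k] by auto
  have nz: "cf_den s (Suc (Suc n)) \<noteq> 0" using Suc a[of n] by (metis leading_coeff_0_iff mult_eq_0_iff)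
  let ?p = "cf_partial s (Suc (Suc n)) * cf_den s (Suc (Suc n))"
  have "degree (cf_den s (Suc n)) < degree ?p"
    using Suc degree_cf_partial_pos[of n] a nz by (simp add: degree_mult_eq)
  moreover have "cf_den s (Suc (Suc (Suc n))) = ?p + cf_den s (Suc n)"
    by (rule cf_num_den_simps)
  ultimately have "degree (cf_den s (Suc (Suc (Suc n)))) = degree ?p"
      "lead_coeff (cf_den s (Suc (Suc (Suc n)))) = lead_coeff ?p"
    by (simp_all add: degree_add_eq_left coeff_eq_0)
  moreover have "degree ?p = degree (cf_partial s (Suc (Suc n))) + degree (cf_den s (Suc (Suc n)))"
    using a nz by (rule degree_mult_eq)
  moreover have "lead_coeff ?p = lead_coeff (cf_partial s (Suc (Suc n))) * lead_coeff (cf_den s (Suc (Suc n)))"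
    by (rule lead_coeff_mult)
  moreover have "degree (cf_den s (Suc n)) \<le> degree (cf_den s (Suc (Suc n)))" using Suc by simp
  ultimately show ?case using nz by (simp only: simp_thms)
qed

lemma cf_den_nonzero: "cf_den s (Suc n) \<noteq> 0"
  and lead_coeff_cf_den:
    "lead_coeff (cf_den s (Suc (Suc n))) = lead_coeff (cf_partial s (Suc n)) * lead_coeff (cf_den s (Suc n))"
  using cf_den_step by blast+

lemma degree_cf_den_less: "degree (cf_den s (Suc n)) < degree (cf_den s (Suc (Suc n)))"
  using cf_den_step[of n] degree_cf_partial_pos[of n] by simp

lemma degree_cf_den_ge: "n \<le> degree (cf_den s (Suc n))"
  by (induction n) (use degree_cf_den_less Suc_leI order.strict_trans1 in blast)+

lemma subdegree_cf_err: "fls_subdegree (cf_err s n) = int (degree (cf_den s (Suc n)))"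
proof (induction n)
  case 0
  then show ?case by (simp add: cf_err_def cf_num_den_simps)
next
  case (Suc n)
  have "cf_complete s (Suc n) \<noteq> 0" using cf_err_eq[of n] cf_err_nonzero[of n] by auto
  then have "fls_subdegree (cf_err s n) = fls_subdegree (cf_complete s (Suc n)) + fls_subdegree (cf_err s (Suc n))"
    using cf_err_nonzero[of "Suc n"] unfolding cf_err_eq[of n] by (simp del: cf_complete.simps)
  then show ?case using Suc degree_cf_partial[of n] cf_den_step[of n] by simp
qed

text \<open>In each step the leading coefficient of the error is divided, up to sign, and that of
  the denominator multiplied, by that of the same partial quotient.\<close>

lemma base_cf_err:
  "cf_err s n $$ fls_subdegree (cf_err s n) * lead_coeff (cf_den s (Suc n)) = (- 1) ^ n"
proof (induction n)
  case 0
  then show ?case by (simp add: cf_err_def cf_num_den_simps)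
next
  case (Suc n)
  let ?e = "\<lambda>n. cf_err s n $$ fls_subdegree (cf_err s n)"
  have "?e n = - (lead_coeff (cf_partial s (Suc n)) * ?e (Suc n))"
  proof -
    have nz: "cf_complete s (Suc n) \<noteq> 0" using cf_err_eq[of n] cf_err_nonzero[of n] by auto
    let ?c = "cf_complete s (Suc n) * cf_err s (Suc n)"
    have "cf_err s n = - ?c" using cf_err_eq[of n] by simp
    then have "?e n = - (?c $$ fls_subdegree ?c)" by simp
    also have "fls_subdegree ?c = fls_subdegree (cf_complete s (Suc n)) + fls_subdegree (cf_err s (Suc n))"
      using nz cf_err_nonzero by (rule fls_subdegree_mult)
    finally show ?thesis unfolding lead_coeff_cf_partial fls_times_base .
  qed
  then have "?e (Suc n) * lead_coeff (cf_den s (Suc (Suc n))) = - (?e n * lead_coeff (cf_den s (Suc n)))"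
    by (simp add: lead_coeff_cf_den[of n])
  then show ?case unfolding Suc by simp
qed

end

subsection \<open>Square roots of polynomials\<close>

definition cf_norm :: "'a::field poly \<Rightarrow> 'a fls \<Rightarrow> nat \<Rightarrow> 'a poly" where
  "cf_norm D s n = (cf_num s n)\<^sup>2 - D * (cf_den s n)\<^sup>2"

locale sqrt_series =
  fixes D :: "'a::field_char_0 poly" and s :: "'a fls" and d :: nat
  assumes sq: "s\<^sup>2 = poly_to_lser D"
    and monic: "lead_coeff D = 1"
    and not_square: "\<not> (\<exists>q. D = q\<^sup>2)"
    and degree_D: "degree D = 2 * d"
begin

lemma d_pos: "d > 0"
proof (rule ccontr)
  assume "\<not> d > 0"
  then have "D = 1\<^sup>2"
    using degree_D monic by (auto simp: one_pCons power2_eq_square elim!: degree_eq_zeroE)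
  then show False using not_square by blast
qed

lemma D_nonzero: "D \<noteq> 0" using monic by auto
lemma s_nonzero: "s \<noteq> 0" using sq D_nonzero by auto

lemma subdegree_s: "fls_subdegree s = - int d"
proof -
  have "2 * fls_subdegree s = - int (degree D)"
    using arg_cong[OF sq, of fls_subdegree] by (simp add: fls_subdegree_pow)
  then show ?thesis by (simp add: degree_D)
qed

text \<open>The sign that tells the two square roots of the monic \<open>D\<close> apart.\<close>

definition \<sigma> where "\<sigma> = s $$ fls_subdegree s"

lemma \<sigma>_sq: "\<sigma>\<^sup>2 = 1"
proof -
  have "\<sigma>\<^sup>2 = (s * s) $$ (fls_subdegree s + fls_subdegree s)"
    unfolding fls_times_base by (simp add: \<sigma>_def power2_eq_square)
  also have "\<dots> = poly_to_lser D $$ (- int (degree D))"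
    using sq by (simp add: power2_eq_square subdegree_s degree_D)
  finally show ?thesis using monic by (simp del: poly_to_lser_nth_neg add: poly_to_lser_nth)
qed

lemma \<sigma>_cases: "\<sigma> = 1 \<or> \<sigma> = - 1" using \<sigma>_sq by (simp add: power2_eq_1_iff)

sublocale irrational_series s
proof
  fix P Q assume "poly_to_lser P = s * poly_to_lser Q"
  \<comment> \<open>the descent for the trivial valuation, whose maximal ideal is zero\<close>
  interpret trivial: valuation_subring "UNIV :: 'a set" by unfold_locales auto
  have M: "trivial.\<M> = {0}" "trivial.\<O> = UNIV"
    unfolding trivial.\<M>_def trivial.\<mm>_def trivial.\<O>_def by (auto intro: fls_eqI)
  have "s \<noteq> poly_to_lser F" for F
    using sq not_square by (metis poly_to_lser_eq_iff poly_to_lser_power)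
  then show "Q = 0"
    using trivial.sqrt_irrational_mod[OF _ sq, of P Q] \<open>poly_to_lser P = s * poly_to_lser Q\<close> by (simp add: M)
qed

lemma cf_norm_eq:
  "poly_to_lser (cf_norm D s n) = cf_err s n * (poly_to_lser (cf_num s n) + s * poly_to_lser (cf_den s n))"
  by (simp add: cf_norm_def cf_err_def sq[symmetric] power2_eq_square algebra_simps)

lemma cf_norm_nonzero: "cf_norm D s n \<noteq> 0"
proof -
  interpret neg: irrational_series "- s"
    by unfold_locales (metis irrational minus_equation_iff mult_minus_left poly_to_lser_minus)
  have "poly_to_lser (cf_num s n) + s * poly_to_lser (cf_den s n) \<noteq> 0"
  proof
    assume "poly_to_lser (cf_num s n) + s * poly_to_lser (cf_den s n) = 0"
    then have *: "poly_to_lser (cf_num s n) = - s * poly_to_lser (cf_den s n)"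
      by (simp add: eq_neg_iff_add_eq_0)
    then have "cf_den s n = 0" by (rule neg.irrational)
    moreover from this * have "cf_num s n = 0" by simp
    ultimately have "cf_err s n = 0" by (simp add: cf_err_def)
    then show False using cf_err_nonzero by simp
  qed
  then show ?thesis using cf_norm_eq[of n] cf_err_nonzero[of n] by (metis mult_eq_0_iff poly_to_lser_0)
qed

text \<open>The norm is the error times its conjugate. The conjugate is the error plus twice
  \<open>s\<close> times the denominator, and the error has higher order, so both leading terms are
  known.\<close>

lemma degree_cf_norm:
    "int (degree (cf_norm D s (Suc n))) = int d + degree (cf_den s (Suc n)) - degree (cf_den s (Suc (Suc n)))"
  and lead_coeff_cf_norm:
    "lead_coeff (cf_norm D s (Suc n)) * lead_coeff (cf_partial s (Suc n)) = (- 1) ^ Suc n * 2 * \<sigma>"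
proof -
  let ?m = "Suc n"
  let ?c = "poly_to_lser (cf_num s ?m) + s * poly_to_lser (cf_den s ?m)"
  let ?t = "s * poly_to_lser (cf_den s ?m)"
  define k where "k = fls_subdegree ?t"
  have k: "k = - int d - degree (cf_den s ?m)"
    using s_nonzero cf_den_nonzero[of n] by (simp add: k_def subdegree_s)
  have base_t: "?t $$ k = \<sigma> * lead_coeff (cf_den s ?m)"
    using fls_times_base[of s "poly_to_lser (cf_den s ?m)"]
    by (simp only: k \<sigma>_def subdegree_s subdegree_poly_to_lser diff_conv_add_uminus poly_to_lser_nth_neg)
  have c: "?c = cf_err s ?m + 2 * ?t" by (simp add: cf_err_def algebra_simps)
  have err: "cf_err s ?m $$ i = 0" if "i \<le> k" for i
    using that k d_pos by (intro fls_eq0_below_subdegree) (simp add: subdegree_cf_err)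
  have two: "(2 * ?t) $$ i = 2 * ?t $$ i" for i by (simp only: mult_2 fls_plus_nth)
  have sub_c: "fls_subdegree ?c = k"
  proof (rule fls_subdegree_eqI)
    have "\<sigma> \<noteq> 0" using \<sigma>_sq by auto
    then show "?c $$ k \<noteq> 0"
      unfolding c fls_plus_nth two base_t using err cf_den_nonzero[of n] by simp
    show "?c $$ i = 0" if "i < k" for i
      unfolding c fls_plus_nth two using that err by (simp add: k_def)
  qed
  have base_c: "?c $$ k = 2 * \<sigma> * lead_coeff (cf_den s ?m)"
    unfolding c fls_plus_nth two base_t using err by simp
  have c_nz: "?c \<noteq> 0" using cf_norm_eq[of ?m] cf_norm_nonzero[of ?m]
    by (metis mult_zero_right poly_to_lser_eq_0_iff)
  have "- int (degree (cf_norm D s ?m)) = fls_subdegree (cf_err s ?m * ?c)"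
    using cf_norm_eq[of ?m] by (metis subdegree_poly_to_lser)
  also have "\<dots> = fls_subdegree (cf_err s ?m) + k"
    using fls_subdegree_mult[OF cf_err_nonzero[of ?m] c_nz] sub_c by simp
  finally show "int (degree (cf_norm D s ?m)) = int d + degree (cf_den s ?m) - degree (cf_den s (Suc ?m))"
    using k by (simp add: subdegree_cf_err)
  have "lead_coeff (cf_norm D s ?m) = (cf_err s ?m * ?c) $$ fls_subdegree (cf_err s ?m * ?c)"
    using base_poly_to_lser[of "cf_norm D s ?m"] by (simp only: cf_norm_eq)
  also have "\<dots> = cf_err s ?m $$ fls_subdegree (cf_err s ?m) * ?c $$ fls_subdegree ?c"
    unfolding fls_subdegree_mult[OF cf_err_nonzero[of ?m] c_nz] fls_times_base ..
  finally have "lead_coeff (cf_norm D s ?m) =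
      cf_err s ?m $$ fls_subdegree (cf_err s ?m) * (2 * \<sigma> * lead_coeff (cf_den s ?m))"
    unfolding sub_c base_c .
  then have "lead_coeff (cf_norm D s ?m) * lead_coeff (cf_partial s ?m) =
      cf_err s ?m $$ fls_subdegree (cf_err s ?m) * lead_coeff (cf_den s (Suc ?m)) * (2 * \<sigma>)"
    unfolding lead_coeff_cf_den[of n] by (simp add: algebra_simps)
  then show "lead_coeff (cf_norm D s ?m) * lead_coeff (cf_partial s ?m) = (- 1) ^ ?m * 2 * \<sigma>"
    unfolding base_cf_err by (simp add: algebra_simps)
qed

text \<open>For consecutive convergents \<open>p/q\<close>, \<open>p'/q'\<close>, \<open>M n\<close>
  is the rational part of \<open>(p' + s * q') * (p - s * q)\<close>, where \<open>s\<close> has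
  coefficient \<open>(- 1) ^ n\<close> by \<open>cf_det\<close>. The first identity takes norms; the
  second multiplies by \<open>p' - s * q'\<close> and compares coefficients of
  \<open>s\<close>.\<close>

lemma cf_norm_mixed:
  defines "M \<equiv> \<lambda>n. cf_num s (Suc n) * cf_num s n - D * cf_den s (Suc n) * cf_den s n"
  shows "(M n)\<^sup>2 - cf_norm D s (Suc n) * cf_norm D s n = D"
    and "M n * cf_den s (Suc n) = cf_norm D s (Suc n) * cf_den s n + (- 1) ^ n * cf_num s (Suc n)"
proof -
  have det: "cf_num s n * cf_den s (Suc n) = cf_num s (Suc n) * cf_den s n + (- 1) ^ n"
    using cf_det[of s n] by (simp add: algebra_simps)
  have "(M n)\<^sup>2 - cf_norm D s (Suc n) * cf_norm D s n
      = D * (cf_num s n * cf_den s (Suc n) - cf_num s (Suc n) * cf_den s n)\<^sup>2"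
    by (simp add: M_def cf_norm_def power2_eq_square algebra_simps)
  then show "(M n)\<^sup>2 - cf_norm D s (Suc n) * cf_norm D s n = D"
    unfolding cf_det by (simp flip: power_mult_distrib power_mult add: power2_eq_square)
  have "M n * cf_den s (Suc n) = cf_num s (Suc n) * (cf_num s n * cf_den s (Suc n))
      - D * (cf_den s (Suc n))\<^sup>2 * cf_den s n"
    by (simp add: M_def power2_eq_square algebra_simps)
  also have "\<dots> = cf_norm D s (Suc n) * cf_den s n + (- 1) ^ n * cf_num s (Suc n)"
    unfolding det by (simp add: cf_norm_def power2_eq_square algebra_simps)
  finally show "M n * cf_den s (Suc n) = cf_norm D s (Suc n) * cf_den s n + (- 1) ^ n * cf_num s (Suc n)" .
qed

end

section \<open>Gauss' lemma and division with remainder over the valuation ring\<close>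

context valuation_subring
begin

text \<open>A polynomial with a coefficient outside \<open>A\<close> becomes primitive only by a
  multiplier in \<mm>, and that multiplier makes everything integral vanish modulo \<mm>.
  Integrality is proved below by this contradiction.\<close>

lemma scale_not_\<O>:
  assumes "poly_to_lser q \<notin> \<O>"
  obtains c where "c \<in> \<mm>" "poly_to_lser (smult c q) \<in> \<O>" "poly_to_lser (smult c q) \<notin> \<M>"
proof -
  have "q \<noteq> 0" using assms \<M>_\<O>[OF \<M>_0] by auto
  then obtain c where c: "c \<noteq> 0" "poly_to_lser (smult c q) \<in> \<O>" "poly_to_lser (smult c q) \<notin> \<M>"
    by (metis scale_polys)
  obtain i where i: "coeff q i \<notin> A" using assms by (auto simp: \<O>_poly_iff)
  then have "inverse (coeff q i) * (c * coeff q i) \<in> \<mm>"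
    using c(2) inverse_ideal by (auto simp: \<O>_poly_iff simp del: poly_to_lser_smult)
  moreover have "coeff q i \<noteq> 0" using i by auto
  ultimately have "c \<in> \<mm>" by (simp add: field_simps)
  then show thesis using c that by blast
qed

lemma \<O>_cancel:
  assumes "f \<in> \<O>" "f \<notin> \<M>" "f * poly_to_lser q \<in> \<O>"
  shows "poly_to_lser q \<in> \<O>"
proof (rule ccontr)
  assume "poly_to_lser q \<notin> \<O>"
  then obtain c where c: "c \<in> \<mm>" "poly_to_lser (smult c q) \<in> \<O>" "poly_to_lser (smult c q) \<notin> \<M>"
    by (rule scale_not_\<O>)
  have "fls_const c * (f * poly_to_lser q) \<in> \<M>" using assms c(1) by auto
  moreover have "fls_const c * (f * poly_to_lser q) = f * poly_to_lser (smult c q)" by simp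
  ultimately have "f * poly_to_lser (smult c q) \<in> \<M>" by metis
  then show False using prime_\<M> assms c by blast
qed

lemma leads_at_lead_coeff:
  assumes "poly_to_lser g \<in> \<O>" "lead_coeff g \<notin> \<mm>"
  shows "leads_at (poly_to_lser g) (- int (degree g))"
  using assms vanishes_below_subdegree[of "poly_to_lser g"] by (simp add: leads_at_def)

text \<open>Otherwise scale the quotient to be primitive by some \<open>c\<close> in \<mm>. Then
  \<open>c * f\<close> vanishes modulo \<mm>, so the scaled quotient times \<open>g\<close> agrees
  with minus the scaled remainder, whose degree is too small.\<close>

lemma div_mod_\<O>:
  assumes f: "poly_to_lser f \<in> \<O>" and g: "poly_to_lser g \<in> \<O>" "lead_coeff g \<notin> \<mm>"
  shows "poly_to_lser (f div g) \<in> \<O>" "poly_to_lser (f mod g) \<in> \<O>"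
proof -
  let ?q = "f div g" and ?r = "f mod g"
  have g0: "g \<noteq> 0" using g(2) by auto
  show q: "poly_to_lser ?q \<in> \<O>"
  proof (rule ccontr)
    assume "poly_to_lser ?q \<notin> \<O>"
    then obtain c where c: "c \<in> \<mm>" "poly_to_lser (smult c ?q) \<in> \<O>" "poly_to_lser (smult c ?q) \<notin> \<M>"
      by (rule scale_not_\<O>)
    then obtain j where j: "leads_at (poly_to_lser (smult c ?q)) j" by (metis leads_at_exists)
    have "f = ?q * g + ?r" by simp
    then have "smult c f = smult c ?q * g + smult c ?r" by (metis smult_add_right mult_smult_left)
    then have "smult c ?q * g - smult (- c) ?r = smult c f" by simp
    then have "poly_to_lser (smult c ?q * g) - poly_to_lser (smult (- c) ?r) = fls_const c * poly_to_lser f"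
      by (metis poly_to_lser_diff poly_to_lser_smult)
    also have "\<dots> \<in> \<M>" using c(1) f by auto
    finally have "leads_at (poly_to_lser (smult (- c) ?r)) (j + - int (degree g))"
      using leads_at_cong leads_at_mult[OF j leads_at_lead_coeff[OF g]] by (metis poly_to_lser_mult)
    moreover from this have "?r \<noteq> 0" by (auto dest: leads_at_not_\<M>)
    moreover have "degree (smult (- c) ?r) \<le> degree ?r" by (rule degree_smult_le)
    ultimately show False
      using leads_at_poly_ge[of "smult (- c) ?r"] leads_at_poly_nonpos[OF j] degree_mod_less[OF g0, of f]
      by fastforce
  qed
  have "?r = f - ?q * g" by (simp add: minus_div_mult_eq_mod)
  then show "poly_to_lser ?r \<in> \<O>" using f g q by auto
qed

lemma leads_at_diff_higher:
  assumes "leads_at f k" "g \<in> \<O>" "vanishes_below g (k + 1)"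
  shows "leads_at (f - g) k"
proof -
  have "g $$ k \<in> \<mm>" using assms(3) by (simp add: vanishes_below_def)
  then have "(f - g) $$ k \<notin> \<mm>"
    using assms(1) add_ideal[of "f $$ k - g $$ k" "g $$ k"] by (auto simp: leads_at_def)
  then show ?thesis
    using assms vanishes_below_diff[of f k g] vanishes_below_mono[of g "k + 1" k]
    by (auto simp: leads_at_def)
qed

lemma leads_at_1: "leads_at 1 0"
  by (auto simp: leads_at_def vanishes_below_def)

end

subsection \<open>Reduction of the square root\<close>

text \<open>\<open>nonsquare\<close> says that the reduction of \<open>D\<close> is not a square:
  otherwise the reduction of \<open>s\<close> would be a polynomial, namely that of
  \<open>lser_floor s\<close>.\<close>

locale good_place = valuation_subring A + sqrt_series D s d
  for A :: "'a::field_char_0 set" and D :: "'a poly" and s :: "'a fls" and d :: nat +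
  assumes half_mem: "inverse 2 \<in> A"
    and D_\<O>: "poly_to_lser D \<in> \<O>"
    and nonsquare: "poly_to_lser (D - (lser_floor s)\<^sup>2) \<notin> \<M>"
begin

abbreviation "\<L> \<equiv> poly_to_lser"

lemma two_unit: "2 \<notin> \<mm>"
  using not_ideal_inverse[of 2] half_mem by auto

lemma \<sigma>_mem: "\<sigma> \<in> A" "\<sigma> \<notin> \<mm>"
  using \<sigma>_cases by auto

text \<open>Comparing coefficients in \<open>s\<^sup>2 = \<L> D\<close> gives each coefficient of
  \<open>s\<close> from the earlier ones after division by \<open>2 * \<sigma>\<close>, which is a
  unit.\<close>

lemma s_\<O>: "s \<in> \<O>"
proof -
  have base: "s $$ (- int d) = \<sigma>" by (simp add: \<sigma>_def subdegree_s)
  have "s $$ (int k - int d) \<in> A" for k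
  proof (induction k rule: less_induct)
    case (less k)
    show ?case
    proof (cases "k = 0")
      case True
      then show ?thesis using \<sigma>_mem(1) by (simp add: base)
    next
      case False
      let ?I = "{- int d..int k - int d}" and ?f = "\<lambda>i. s $$ i * s $$ (int k - 2 * int d - i)"
      let ?J = "?I - {- int d} - {int k - int d}"
      have "sum ?f ?I = \<L> D $$ (int k - 2 * int d)"
        unfolding sq[symmetric] power2_eq_square fls_times_nth(2) by (simp add: subdegree_s)
      moreover have "sum ?f ?I = ?f (- int d) + (?f (int k - int d) + sum ?f ?J)"
        using False by (subst sum.remove[of _ "- int d"], simp_all, subst sum.remove[of _ "int k - int d"], auto)
      moreover have "?f (- int d) = \<sigma> * s $$ (int k - int d)" "?f (int k - int d) = \<sigma> * s $$ (int k - int d)"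
        by (simp_all add: base)
      ultimately have "\<sigma> * s $$ (int k - int d) + (\<sigma> * s $$ (int k - int d) + sum ?f ?J)
          = \<L> D $$ (int k - 2 * int d)"
        by (simp only:)
      then have "2 * \<sigma> * s $$ (int k - int d) = \<L> D $$ (int k - 2 * int d) - sum ?f ?J"
        by (simp only: mult_2 eq_diff_eq distrib_right add.assoc)
      then have "inverse 2 * \<sigma> * (2 * \<sigma> * s $$ (int k - int d)) =
          inverse 2 * \<sigma> * (\<L> D $$ (int k - 2 * int d) - sum ?f ?J)" by simp
      moreover have "inverse 2 * \<sigma> * (2 * \<sigma> * s $$ (int k - int d)) = s $$ (int k - int d)"
        using \<sigma>_cases by auto
      moreover have "sum ?f ?J \<in> A"
      proof (rule sum_mem)
        fix i assume i: "i \<in> ?J"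
        have "s $$ (int (nat (i + int d)) - int d) \<in> A" using i by (intro less) auto
        moreover have "s $$ (int (nat (int k - int d - i)) - int d) \<in> A" using i by (intro less) auto
        ultimately show "?f i \<in> A" using i by (auto simp: algebra_simps)
      qed
      moreover have "\<L> D $$ (int k - 2 * int d) \<in> A" using D_\<O> by (rule \<O>_nth)
      ultimately show ?thesis
        using mult_mem[OF mult_mem[OF half_mem \<sigma>_mem(1)] diff_mem] by (simp only:)
    qed
  qed
  note mem = this
  have "s $$ i \<in> A" for i
  proof (cases "i < - int d")
    case False
    then show ?thesis using mem[of "nat (i + int d)"] by simp
  qed (simp add: subdegree_s)
  then show ?thesis by (simp add: \<O>_def)
qed

lemma leads_at_s: "leads_at s (- int d)"
  using s_\<O> \<sigma>_mem(2) vanishes_below_subdegree[of s] by (simp add: leads_at_def \<sigma>_def subdegree_s)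

lemma irrational_mod:
  assumes "\<L> P \<in> \<O>" "\<L> Q \<in> \<O>" "\<L> P - s * \<L> Q \<in> \<M> \<or> \<L> P + s * \<L> Q \<in> \<M>"
  shows "\<L> P \<in> \<M> \<and> \<L> Q \<in> \<M>"
proof -
  have frac: "s - \<L> (lser_floor s) \<notin> \<M>"
  proof
    assume "s - \<L> (lser_floor s) \<in> \<M>"
    then have "(s - \<L> (lser_floor s)) * (s + \<L> (lser_floor s)) \<in> \<M>"
      using s_\<O> floor_\<O> by auto
    moreover have "(s - \<L> (lser_floor s)) * (s + \<L> (lser_floor s)) = \<L> (D - (lser_floor s)\<^sup>2)"
      by (simp add: sq[symmetric] power2_eq_square algebra_simps)
    ultimately show False using nonsquare by simp
  qed
  note irr = sqrt_irrational_mod[OF s_\<O> sq frac]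
  have "\<L> Q \<in> \<M>"
    using assms(3)
  proof
    assume "\<L> P - s * \<L> Q \<in> \<M>"
    then show ?thesis using irr assms by blast
  next
    assume "\<L> P + s * \<L> Q \<in> \<M>"
    then have "\<L> P - s * \<L> (- Q) \<in> \<M>" by simp
    moreover have "\<L> (- Q) \<in> \<O>" using assms(2) by auto
    ultimately have "\<L> (- Q) \<in> \<M>" using irr assms(1) by blast
    then show ?thesis by simp
  qed
  moreover from this have "\<L> P - 0 \<in> \<M>"
    using assms(3) \<M>_cong[of "\<L> P - s * \<L> Q" "\<L> P"] \<M>_cong[of "\<L> P + s * \<L> Q" "\<L> P"] s_\<O>
    by (auto simp: \<M>_mult)
  ultimately show ?thesis by simp
qed

text \<open>Two pairs that have the same norm \<open>g\<close> and agree modulo \<open>g\<close>: the quotient \<open>(p0 + s q0) (pn - s qn) / g\<close> is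
  of the form \<open>u - s v\<close> with polynomials \<open>u, v\<close> and has norm 1.\<close>

lemma pell_step_mod:
  assumes O: "p0 \<in> \<O>" "q0 \<in> \<O>" "pn \<in> \<O>" "qn \<in> \<O>" "g \<in> \<O>" "a \<in> \<O>" "b \<in> \<O>"
    and e: "pn - p0 - g * a \<in> \<M>" "qn - q0 - g * b \<in> \<M>"
      "p0\<^sup>2 - s\<^sup>2 * q0\<^sup>2 - g \<in> \<M>" "pn\<^sup>2 - s\<^sup>2 * qn\<^sup>2 - g \<in> \<M>"
    and g: "g \<notin> \<M>"
  defines "u \<equiv> 1 + p0 * a - s\<^sup>2 * q0 * b" and "v \<equiv> p0 * b - q0 * a"
  shows "u\<^sup>2 - s\<^sup>2 * v\<^sup>2 - 1 \<in> \<M>" "(p0 + s * q0) * (pn - s * qn) - g * (u - s * v) \<in> \<M>"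
proof -
  let ?d1 = "pn - p0 - g * a" and ?d2 = "qn - q0 - g * b"
  have ss [simp, intro]: "s\<^sup>2 \<in> \<O>" "s \<in> \<O>" using s_\<O> by auto
  have uv: "u \<in> \<O>" "v \<in> \<O>" using O by (auto simp: u_def v_def)
  let ?X = "p0 * pn - s\<^sup>2 * q0 * qn - g * u" and ?Y = "p0 * qn - q0 * pn - g * v"
  have "?X = (p0\<^sup>2 - s\<^sup>2 * q0\<^sup>2 - g) + p0 * ?d1 - s\<^sup>2 * q0 * ?d2"
    by (simp add: u_def power2_eq_square algebra_simps)
  also have "\<dots> \<in> \<M>" by (rule \<M>_diff[OF \<M>_add[OF e(3) \<M>_mult[OF O(1) e(1)]] \<M>_mult[OF _ e(2)]]) (use O in auto)
  finally have X: "?X \<in> \<M>" .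
  have "?Y = p0 * ?d2 - q0 * ?d1" by (simp add: v_def algebra_simps)
  also have "\<dots> \<in> \<M>" by (rule \<M>_diff[OF \<M>_mult[OF O(1) e(2)] \<M>_mult[OF O(2) e(1)]])
  finally have Y: "?Y \<in> \<M>" .
  have "(p0 + s * q0) * (pn - s * qn) - g * (u - s * v) = ?X - s * ?Y"
    by (simp add: power2_eq_square algebra_simps)
  also have "\<dots> \<in> \<M>" using X Y s_\<O> by auto
  finally show 1: "(p0 + s * q0) * (pn - s * qn) - g * (u - s * v) \<in> \<M>" .
  have "(p0 - s * q0) * (pn + s * qn) - g * (u + s * v) = ?X + s * ?Y"
    by (simp add: power2_eq_square algebra_simps)
  also have "\<dots> \<in> \<M>" using X Y s_\<O> by auto
  finally have 2: "(p0 - s * q0) * (pn + s * qn) - g * (u + s * v) \<in> \<M>" .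
  let ?n0 = "p0\<^sup>2 - s\<^sup>2 * q0\<^sup>2" and ?nn = "pn\<^sup>2 - s\<^sup>2 * qn\<^sup>2"
  let ?x = "(p0 + s * q0) * (pn - s * qn)" and ?y = "(p0 - s * q0) * (pn + s * qn)"
  \<comment> \<open>After multiplication by \<open>g\<^sup>2\<close> the claim is a combination of
    the known congruences; the factor cancels because \<M> is prime.\<close>
  have "g\<^sup>2 * (u\<^sup>2 - s\<^sup>2 * v\<^sup>2 - 1) =
      (?n0 - g) * ?nn + g * (?nn - g) - (?x - g * (u - s * v)) * ?y - g * (u - s * v) * (?y - g * (u + s * v))"
    by (simp add: power2_eq_square algebra_simps)
  also have "\<dots> \<in> \<M>"
    by (rule \<M>_diff[OF \<M>_diff[OF \<M>_add[OF \<M>_mult'[OF e(3)] \<M>_mult[OF O(5) e(4)]]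
        \<M>_mult'[OF 1]] \<M>_mult[OF _ 2]]) (use O uv in auto)
  finally have "g\<^sup>2 * (u\<^sup>2 - s\<^sup>2 * v\<^sup>2 - 1) \<in> \<M>" .
  moreover have "g\<^sup>2 \<notin> \<M>" using g O(5) prime_\<M> by (auto simp: power2_eq_square)
  moreover have "g\<^sup>2 \<in> \<O>" "u\<^sup>2 - s\<^sup>2 * v\<^sup>2 - 1 \<in> \<O>" using O uv by auto
  ultimately show "u\<^sup>2 - s\<^sup>2 * v\<^sup>2 - 1 \<in> \<M>" using prime_\<M> by blast
qed

end

context valuation_subring
begin

text \<open>\<open>rep 0 = 0\<close> lets \<open>rep\<close> act coefficientwise on polynomials. By
  the last property a nonzero reduced polynomial has a unit as leading coefficient, so one can
  divide by it.\<close>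

lemma exists_finite_reduction:
  assumes "finite R" "R \<subseteq> A" "\<And>x. x \<in> A \<Longrightarrow> \<exists>r\<in>R. x - r \<in> \<mm>"
  obtains rep R' where "finite R'" "R' \<subseteq> A" "rep 0 = 0" "\<And>x. x \<in> A \<Longrightarrow> rep x \<in> R'"
    "\<And>x. x \<in> A \<Longrightarrow> x - rep x \<in> \<mm>" "\<And>x. x \<in> A \<Longrightarrow> rep x \<in> \<mm> \<Longrightarrow> rep x = 0"
proof -
  obtain \<rho> where \<rho>: "\<And>x. x \<in> A \<Longrightarrow> \<rho> x \<in> R \<and> x - \<rho> x \<in> \<mm>" using assms(3) by metis
  define rep where "rep x = (if x \<in> \<mm> then 0 else \<rho> x)" for x
  have diff: "x - rep x \<in> \<mm>" if "x \<in> A" for x using that \<rho> by (simp add: rep_def)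
  show thesis
  proof (rule that[of "insert 0 R" rep])
    show "rep x = 0" if "x \<in> A" "rep x \<in> \<mm>" for x
      using add_ideal[OF diff[OF that(1)] that(2)] by (simp add: rep_def)
  qed (use assms \<rho> diff in \<open>auto simp: rep_def\<close>)
qed

lemma finite_polys_bounded_degree:
  fixes R :: "'a set"
  assumes "finite R"
  shows "finite {f. degree f \<le> n \<and> (\<forall>i. coeff f i \<in> R)}"
proof (rule finite_subset)
  have "set (coeffs f) \<subseteq> R \<and> length (coeffs f) \<le> Suc n"
    if "degree f \<le> n" "\<forall>i. coeff f i \<in> R" for f :: "'a poly"
    using that range_coeff[of f] by (auto simp: coeffs_def)
  then show "{f. degree f \<le> n \<and> (\<forall>i. coeff f i \<in> R)} \<subseteq> coeffs -` {xs. set xs \<subseteq> R \<and> length xs \<le> Suc n}"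
    by blast
  show "finite (coeffs -` {xs. set xs \<subseteq> R \<and> length xs \<le> Suc n})"
    using finite_lists_length_le[OF assms] by (rule finite_vimageI) (simp add: inj_def coeffs_eq_iff)
qed

end

subsection \<open>The Pell equation modulo a place\<close>

locale good_finite_place = good_place A D s d
  for A :: "'a::field_char_0 set" and D :: "'a poly" and s :: "'a fls" and d :: nat +
  assumes finite_residue_field: "\<exists>R. finite R \<and> R \<subseteq> A \<and> (\<forall>x\<in>A. \<exists>r\<in>R. x - r \<in> \<mm>)"
begin

lemma cf_not_both_zero: "cf_num s n \<noteq> 0 \<or> cf_den s n \<noteq> 0"
  using cf_err_nonzero[of n] by (auto simp: cf_err_def)

lemma scaled_err:
  "\<L> (smult c (cf_num s n)) - s * \<L> (smult c (cf_den s n)) = fls_const c * cf_err s n"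
  by (simp add: cf_err_def algebra_simps)

lemma scaled_norm:
  "(smult c (cf_num s n))\<^sup>2 - D * (smult c (cf_den s n))\<^sup>2 = smult (c\<^sup>2) (cf_norm D s n)"
  by (simp add: cf_norm_def power2_eq_square smult_diff_right mult.left_commute)

lemma scaled_err_nth:
  assumes "i < int (degree (cf_den s (Suc n)))"
  shows "(fls_const c * cf_err s n) $$ i = 0"
  using assms by (simp add: subdegree_cf_err)

text \<open>The primitive convergents have norms of degree at most \<open>d\<close> that do not
  vanish modulo \<mm>. By pigeonhole infinitely many share the reduced norm and the reduced
  remainders modulo it. \<open>pell_step_mod\<close> combines a fixed one with a late one.\<close>

lemma pell_mod:
  obtains U V k where "\<L> U \<in> \<O>" "\<L> V \<in> \<O>" "\<L> (U\<^sup>2 - D * V\<^sup>2) - 1 \<in> \<M>"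
    "leads_at (\<L> U - s * \<L> V) k" "k > B"
proof -
  obtain R0 where "finite R0" "R0 \<subseteq> A" "\<And>x. x \<in> A \<Longrightarrow> \<exists>r\<in>R0. x - r \<in> \<mm>"
    using finite_residue_field by blast
  then obtain rep R where R: "finite R" "R \<subseteq> A" "rep 0 = 0" "\<And>x. x \<in> A \<Longrightarrow> rep x \<in> R"
      and rep: "\<And>x. x \<in> A \<Longrightarrow> x - rep x \<in> \<mm>" "\<And>x. x \<in> A \<Longrightarrow> rep x \<in> \<mm> \<Longrightarrow> rep x = 0"
    using exists_finite_reduction by metis
  define red where "red = map_poly rep"
  have coeff_red: "coeff (red f) i = rep (coeff f i)" for f i
    using R(3) by (simp add: red_def coeff_map_poly)
  have red_O: "\<L> (red f) \<in> \<O>" if "\<L> f \<in> \<O>" for f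
    using that R(2,4) by (auto simp: \<O>_poly_iff coeff_red)
  have red_M: "\<L> f - \<L> (red f) \<in> \<M>" if "\<L> f \<in> \<O>" for f
  proof -
    have "\<L> (f - red f) \<in> \<M>"
      unfolding \<M>_poly_iff using that rep(1) by (simp add: \<O>_poly_iff coeff_red)
    then show ?thesis by simp
  qed
  have red_eq: "\<L> f - \<L> g \<in> \<M>" if "\<L> f \<in> \<O>" "\<L> g \<in> \<O>" "red f = red g" for f g
    using \<M>_diff[OF red_M[OF that(1)] red_M[OF that(2)]] that(3) by simp
  have red_deg: "degree (red f) \<le> degree f" for f
    by (rule degree_le) (simp add: coeff_red coeff_eq_0 R(3))
  have red_lead: "lead_coeff (red f) \<notin> \<mm>" if f: "\<L> f \<in> \<O>" "\<L> f \<notin> \<M>" for f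
  proof
    assume *: "lead_coeff (red f) \<in> \<mm>"
    have "lead_coeff (red f) = 0"
      using rep(2)[of "coeff f (degree (red f))"] * f(1) unfolding coeff_red by (simp add: \<O>_poly_iff)
    then have "red f = 0" by simp
    then show False using red_M[OF f(1)] f(2) by simp
  qed

  have "\<exists>c. c \<noteq> 0 \<and> \<L> (smult c (cf_num s (Suc n))) \<in> \<O> \<and> \<L> (smult c (cf_den s (Suc n))) \<in> \<O> \<and>
      (\<L> (smult c (cf_num s (Suc n))) \<notin> \<M> \<or> \<L> (smult c (cf_den s (Suc n))) \<notin> \<M>)" for n
    using scale_polys[OF cf_not_both_zero[of "Suc n"]] by metis
  then obtain c where c: "\<And>n. c n \<noteq> 0 \<and> \<L> (smult (c n) (cf_num s (Suc n))) \<in> \<O> \<and>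
      \<L> (smult (c n) (cf_den s (Suc n))) \<in> \<O> \<and>
      (\<L> (smult (c n) (cf_num s (Suc n))) \<notin> \<M> \<or> \<L> (smult (c n) (cf_den s (Suc n))) \<notin> \<M>)"
    by metis
  define P where "P n = smult (c n) (cf_num s (Suc n))" for n
  define Q where "Q n = smult (c n) (cf_den s (Suc n))" for n
  define \<nu> where "\<nu> n = (P n)\<^sup>2 - D * (Q n)\<^sup>2" for n
  have PQ: "\<L> (P n) \<in> \<O>" "\<L> (Q n) \<in> \<O>" "\<L> (P n) \<notin> \<M> \<or> \<L> (Q n) \<notin> \<M>" for n
    using c[of n] by (auto simp: P_def Q_def)
  have err_M: "\<L> (P n) - s * \<L> (Q n) \<notin> \<M>" "\<L> (P n) + s * \<L> (Q n) \<notin> \<M>" for n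
    using irrational_mod[OF PQ(1,2)] PQ(3) by blast+
  have err_O: "\<L> (P n) - s * \<L> (Q n) \<in> \<O>" "\<L> (P n) + s * \<L> (Q n) \<in> \<O>" for n
    using PQ s_\<O> by auto
  have \<nu>_L: "\<L> (\<nu> n) = (\<L> (P n) - s * \<L> (Q n)) * (\<L> (P n) + s * \<L> (Q n))" for n
    by (simp add: \<nu>_def sq[symmetric] power2_eq_square algebra_simps)
  have \<nu>_O: "\<L> (\<nu> n) \<in> \<O>" and \<nu>_M: "\<L> (\<nu> n) \<notin> \<M>" for n
    unfolding \<nu>_L using err_M err_O prime_\<M> by blast+
  have \<nu>_deg: "degree (\<nu> n) \<le> d" for n
  proof -
    have "degree (\<nu> n) \<le> degree (cf_norm D s (Suc n))"
      unfolding \<nu>_def P_def Q_def scaled_norm by (rule degree_smult_le)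
    also have "\<dots> \<le> d" using degree_cf_norm[of n] degree_cf_den_less[of n] by linarith
    finally show ?thesis .
  qed
  \<comment> \<open>Unlike the norm itself, its reduced form has a unit as leading coefficient, so
    division by it stays integral.\<close>
  define g where "g n = red (\<nu> n)" for n
  have g: "\<L> (g n) \<in> \<O>" "lead_coeff (g n) \<notin> \<mm>" "degree (g n) \<le> d" for n
    using red_O[OF \<nu>_O] red_lead[OF \<nu>_O \<nu>_M] order.trans[OF red_deg \<nu>_deg] by (auto simp: g_def)
  have g0: "g n \<noteq> 0" for n using g(2)[of n] by auto
  note mod_O = div_mod_\<O>(2)[OF _ g(1,2)] and div_O = div_mod_\<O>(1)[OF _ g(1,2)]
  define key where "key n = (g n, red (P n mod g n), red (Q n mod g n))" for n
  define X where "X = {f. degree f \<le> d \<and> (\<forall>i. coeff f i \<in> R)}"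
  have in_X: "red f \<in> X" if "\<L> f \<in> \<O>" "degree f \<le> d" for f
    using that red_deg[of f] R(4) by (auto simp: X_def coeff_red \<O>_poly_iff)
  have deg_mod: "degree (f mod g n) \<le> d" for f n
    using degree_mod_less[OF g0[of n], of f] g(3)[of n] by auto
  have "range key \<subseteq> X \<times> X \<times> X"
    using in_X[OF \<nu>_O \<nu>_deg] in_X[OF mod_O[OF PQ(1)] deg_mod] in_X[OF mod_O[OF PQ(2)] deg_mod]
    by (auto simp: key_def g_def)
  moreover have "finite X" unfolding X_def using R(1) by (rule finite_polys_bounded_degree)
  then have "finite (X \<times> X \<times> X)" by (intro finite_cartesian_product)
  ultimately have "finite (range key)" by (rule finite_subset)
  then obtain m where m: "infinite {n \<in> UNIV. key n = key m}"
    using pigeonhole_infinite[of "UNIV :: nat set" key] by auto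

  let ?G = "g m"
  obtain jg where jg: "leads_at (\<L> ?G) jg" using leads_at_lead_coeff[OF g(1,2)] by blast
  obtain k0 where k0: "leads_at (\<L> (P m) + s * \<L> (Q m)) k0" using leads_at_exists err_M err_O by metis
  \<comment> \<open>Below, \<open>jg + k = k0 + kn\<close> and \<open>kn >= n\<close>, so this
    choice yields \<open>k > B\<close>.\<close>
  obtain n where n: "n > nat (B - k0 + jg)" "key n = key m"
    using m unfolding infinite_nat_iff_unbounded by auto
  have gn: "g n = ?G" using n(2) by (simp add: key_def)
  define a where "a = P n div ?G - P m div ?G"
  define b where "b = Q n div ?G - Q m div ?G"
  have ab: "\<L> a \<in> \<O>" "\<L> b \<in> \<O>" using div_O PQ by (auto simp: a_def b_def)
  have quot: "\<L> f - \<L> f' - \<L> ?G * \<L> (f div ?G - f' div ?G) \<in> \<M>"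
    if f: "\<L> f \<in> \<O>" "\<L> f' \<in> \<O>" "red (f mod ?G) = red (f' mod ?G)" for f f'
  proof -
    have "f mod ?G - f' mod ?G = f - f' - ?G * (f div ?G - f' div ?G)"
      by (simp add: minus_mult_div_eq_mod[symmetric] algebra_simps)
    moreover have "\<L> (f mod ?G - f' mod ?G) \<in> \<M>" using red_eq mod_O f by simp
    ultimately show ?thesis by (metis poly_to_lser_diff poly_to_lser_mult)
  qed
  have ea: "\<L> (P n) - \<L> (P m) - \<L> ?G * \<L> a \<in> \<M>"
    unfolding a_def using quot[OF PQ(1,1)] n(2) gn by (simp add: key_def)
  have eb: "\<L> (Q n) - \<L> (Q m) - \<L> ?G * \<L> b \<in> \<M>"
    unfolding b_def using quot[OF PQ(2,2)] n(2) gn by (simp add: key_def)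
  have norm: "(\<L> (P i))\<^sup>2 - s\<^sup>2 * (\<L> (Q i))\<^sup>2 - \<L> (g i) \<in> \<M>" for i
    using red_M[OF \<nu>_O[of i]] by (simp add: g_def \<nu>_def sq)
  have G_M: "\<L> ?G \<notin> \<M>" using jg by (rule leads_at_not_\<M>)
  define U where "U = 1 + P m * a - D * Q m * b"
  define V where "V = P m * b - Q m * a"
  have UV_L: "\<L> U = 1 + \<L> (P m) * \<L> a - s\<^sup>2 * \<L> (Q m) * \<L> b" "\<L> V = \<L> (P m) * \<L> b - \<L> (Q m) * \<L> a"
    by (simp_all add: U_def V_def sq)
  note step = pell_step_mod[OF PQ(1,2) PQ(1,2) g(1) ab ea eb norm norm[of n, unfolded gn] G_M, folded UV_L]
  have UV: "\<L> U \<in> \<O>" "\<L> V \<in> \<O>"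
    unfolding UV_L sq by (intro \<O>_diff \<O>_add \<O>_mult \<O>_1 D_\<O> PQ ab)+
  obtain kn where kn: "leads_at (\<L> (P n) - s * \<L> (Q n)) kn" using leads_at_exists err_M err_O by metis
  have "vanishes_below (\<L> (P n) - s * \<L> (Q n)) (int n)"
    unfolding vanishes_below_def P_def Q_def scaled_err
  proof (intro allI impI)
    fix i assume "i < int n"
    also have "n \<le> degree (cf_den s (Suc (Suc n)))"
      using degree_cf_den_ge[of n] degree_cf_den_less[of n] by linarith
    finally show "(fls_const (c n) * cf_err s (Suc n)) $$ i \<in> \<mm>" by (simp only: scaled_err_nth zero_ideal)
  qed
  then have kn_ge: "int n \<le> kn" using vanishes_below_leads[OF kn] by blast
  have lead: "leads_at (\<L> ?G * (\<L> U - s * \<L> V)) (k0 + kn)"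
    using leads_at_cong[OF leads_at_mult[OF k0 kn] step(2)] .
  have "\<L> U - s * \<L> V \<in> \<O>" using UV s_\<O> by auto
  moreover have "\<L> U - s * \<L> V \<notin> \<M>"
    using leads_at_not_\<M>[OF lead] \<M>_mult[OF g(1)] by blast
  ultimately obtain k where k: "leads_at (\<L> U - s * \<L> V) k" by (rule leads_at_exists)
  have "jg + k = k0 + kn" using leads_at_unique[OF leads_at_mult[OF jg k] lead] .
  then have "k > B" using kn_ge n(1) by linarith
  moreover have "\<L> (U\<^sup>2 - D * V\<^sup>2) - 1 \<in> \<M>" using step(1) by (simp add: sq)
  ultimately show thesis using that UV k by blast
qed

text \<open>A solution \<open>(U, V)\<close> modulo \<mm> is compared with the last convergent whose
  denominator has degree at most that of the reduction of \<open>V\<close>. The approximation orders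
  force proportionality modulo \<mm>, and the degrees force the factor \<open>h\<close> to be a
  nonzero constant; the norm is then the square of \<open>h\<close>.\<close>

lemma degenerate_convergents:
  obtains n c where "n \<ge> n1" "c \<noteq> 0" "\<L> (smult c (cf_num s (Suc n))) \<in> \<O>"
    "leads_at (\<L> (smult c (cf_den s (Suc n)))) (- int (degree (cf_den s (Suc n))))"
    "leads_at (\<L> (smult (c\<^sup>2) (cf_norm D s (Suc n)))) 0"
proof -
  obtain U V k where UV: "\<L> U \<in> \<O>" "\<L> V \<in> \<O>" "\<L> (U\<^sup>2 - D * V\<^sup>2) - 1 \<in> \<M>"
    and k: "leads_at (\<L> U - s * \<L> V) k" "k > int d + int (degree (cf_den s (Suc n1)))"
    using pell_mod by metis
  note [intro] = s_\<O> D_\<O>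
  have UVs: "(\<L> U - s * \<L> V) * (\<L> U + s * \<L> V) = \<L> (U\<^sup>2 - D * V\<^sup>2)"
    by (simp add: sq[symmetric] power2_eq_square algebra_simps)
  have lead_norm: "leads_at (\<L> (U\<^sup>2 - D * V\<^sup>2)) 0"
  proof (rule leads_at_cong[OF leads_at_1])
    show "1 - \<L> (U\<^sup>2 - D * V\<^sup>2) \<in> \<M>" using \<M>_uminus[OF UV(3)] by (simp del: poly_to_lser_diff)
  qed
  have "\<L> U + s * \<L> V \<notin> \<M>"
    using leads_at_not_\<M>[OF lead_norm] k(1) UVs \<M>_mult by (metis leads_at_def)
  moreover have "\<L> U + s * \<L> V \<in> \<O>" using UV s_\<O> by auto
  ultimately obtain k' where k': "leads_at (\<L> U + s * \<L> V) k'" using leads_at_exists by blast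
  have "k + k' = 0" using leads_at_unique[OF leads_at_mult[OF k(1) k']] lead_norm unfolding UVs by blast
  have van: "vanishes_below (\<L> U - s * \<L> V) k" "\<L> U - s * \<L> V \<in> \<O>" using k(1) by (auto simp: leads_at_def)
  have "leads_at ((\<L> U + s * \<L> V) - (\<L> U - s * \<L> V)) k'"
    using k(2) \<open>k + k' = 0\<close> by (intro leads_at_diff_higher[OF k' van(2)] vanishes_below_mono[OF van(1)]) simp
  moreover have "(\<L> U + s * \<L> V) - (\<L> U - s * \<L> V) = fls_const 2 * s * \<L> V"
    by (simp add: algebra_simps mult_2[symmetric] fls_const_numeral)
  ultimately have 2: "leads_at (fls_const 2 * s * \<L> V) k'" by simp
  then have V_M: "\<L> V \<notin> \<M>" using leads_at_not_\<M> s_\<O> by (metis \<M>_mult \<O>_const \<O>_mult numeral_mem)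
  then obtain j where j: "leads_at (\<L> V) j" using UV(2) leads_at_exists by blast
  have "leads_at (fls_const 2) 0" using two_unit by (auto simp: leads_at_def vanishes_below_def)
  then have "0 + - int d + j = k'"
    using leads_at_unique[OF leads_at_mult[OF leads_at_mult[OF _ leads_at_s] j] 2] by blast
  \<comment> \<open>\<open>e\<close> is the degree of the reduction of \<open>V\<close>, because
    \<open>2 * s * V\<close> has order \<open>- k\<close> modulo \<mm> and \<open>s\<close> has
    order \<open>- d\<close>.\<close>
  define e where "e = nat (k - int d)"
  have e: "int e = k - int d" "j = - int e" "degree (cf_den s (Suc n1)) \<le> e"
    using k(2) \<open>k + k' = 0\<close> \<open>0 + - int d + j = k'\<close> by (auto simp: e_def)

  define F where "F n \<longleftrightarrow> degree (cf_den s (Suc n)) \<le> e" for n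
  have F_bound: "n \<le> e" if "F n" for n using that degree_cf_den_ge[of n] by (simp add: F_def)
  define n where "n = Greatest F"
  have "F n1" using e(3) by (simp add: F_def)
  then have n: "F n" "n1 \<le> n" "\<not> F (Suc n)"
    using GreatestI_nat[of F n1 e] Greatest_le_nat[of F _ e] F_bound unfolding n_def
    by (auto dest: Suc_n_not_le_n[THEN notE, rotated])
  let ?q = "degree (cf_den s (Suc n))"
  have deg: "?q \<le> e" "e < degree (cf_den s (Suc (Suc n)))" using n by (auto simp: F_def)
  obtain c where c: "c \<noteq> 0" and PO: "\<L> (smult c (cf_num s (Suc n))) \<in> \<O>" and QO: "\<L> (smult c (cf_den s (Suc n))) \<in> \<O>"
    and PQM: "\<L> (smult c (cf_num s (Suc n))) \<notin> \<M> \<or> \<L> (smult c (cf_den s (Suc n))) \<notin> \<M>"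
    by (rule scale_polys[OF cf_not_both_zero])
  define P where "P = smult c (cf_num s (Suc n))"
  define Q where "Q = smult c (cf_den s (Suc n))"
  have PQ: "\<L> P \<in> \<O>" "\<L> Q \<in> \<O>" "\<L> P \<notin> \<M> \<or> \<L> Q \<notin> \<M>" "degree Q \<le> ?q"
    using PO QO PQM degree_smult_le by (auto simp only: P_def Q_def)
  define W where "W = P * V - U * Q"
  have W: "\<L> W \<in> \<M>"
  proof (rule vanishes_below_1_poly)
    \<comment> \<open>Modulo \<mm> the two summands have order at least \<open>(e + 1) - e\<close>
      and \<open>k - e = d\<close>, both positive.\<close>
    have W_L: "\<L> W = (\<L> P - s * \<L> Q) * \<L> V - (\<L> U - s * \<L> V) * \<L> Q"
      by (simp add: W_def algebra_simps)
    have "vanishes_below (\<L> P - s * \<L> Q) (int e + 1)"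
      unfolding vanishes_below_def P_def Q_def scaled_err
    proof (intro allI impI)
      fix i assume "i < int e + 1"
      then have "i < int (degree (cf_den s (Suc (Suc n))))" using deg(2) by linarith
      then show "(fls_const c * cf_err s (Suc n)) $$ i \<in> \<mm>" by (simp only: scaled_err_nth zero_ideal)
    qed
    moreover have "vanishes_below (\<L> V) (- int e)" using j e by (simp add: leads_at_def)
    ultimately have 1: "vanishes_below ((\<L> P - s * \<L> Q) * \<L> V) 1"
      using vanishes_below_mult[of "\<L> P - s * \<L> Q" "int e + 1" "\<L> V" "- int e"] PQ UV s_\<O> by auto
    have "vanishes_below ((\<L> U - s * \<L> V) * \<L> Q) (k + - int (degree Q))"
      using vanishes_below_subdegree[of "\<L> Q"] by (intro vanishes_below_mult van PQ) simp
    then have "vanishes_below ((\<L> U - s * \<L> V) * \<L> Q) 1"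
      using PQ(4) deg e d_pos by (elim vanishes_below_mono) linarith
    with 1 show "vanishes_below (\<L> W) 1" unfolding W_L by (rule vanishes_below_diff)
  qed
  define N where "N = \<L> (U\<^sup>2 - D * V\<^sup>2) - 1"
  have N: "N \<in> \<M>" using UV(3) by (simp add: N_def)
  define h where "h = U * P - D * V * Q"
  have hO: "\<L> h \<in> \<O>" using PQ UV D_\<O> by (auto simp: h_def)
  have Qh: "\<L> Q - \<L> V * \<L> h \<in> \<M>"
  proof -
    have "\<L> Q - \<L> V * \<L> h = - (\<L> U * \<L> W) - \<L> Q * N"
      by (simp add: N_def W_def h_def power2_eq_square algebra_simps)
    then show ?thesis using W N PQ UV by (simp only:) (intro \<M>_diff \<M>_uminus \<M>_mult)
  qed
  have Ph: "\<L> P - \<L> U * \<L> h \<in> \<M>"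
  proof -
    have "\<L> P - \<L> U * \<L> h = - (\<L> D * \<L> V * \<L> W) - \<L> P * N"
      by (simp add: N_def W_def h_def power2_eq_square algebra_simps)
    then show ?thesis using W N PQ UV D_\<O> by (simp only:) (intro \<M>_diff \<M>_uminus \<M>_mult \<O>_mult)
  qed
  have "\<L> h \<notin> \<M>"
    using \<M>_cong[OF Qh] \<M>_cong[OF Ph] PQ(3) UV \<M>_mult by blast
  then obtain jh where jh: "leads_at (\<L> h) jh" using hO leads_at_exists by blast
  have "\<L> V * \<L> h - \<L> Q \<in> \<M>" using \<M>_uminus[OF Qh] by simp
  then have Q_lead: "leads_at (\<L> Q) (j + jh)" using leads_at_cong[OF leads_at_mult[OF j jh]] by blast
  \<comment> \<open>The two inequalities combine to
    \<open>e <= e - jh <= degree Q <= ?q <= e\<close>.\<close>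
  have "jh \<le> 0" using jh by (rule leads_at_poly_nonpos)
  moreover have "- int (degree Q) \<le> j + jh" using Q_lead by (rule leads_at_poly_ge)
  ultimately have jh0: "jh = 0" "?q = e" using PQ(4) deg(1) e(2) by auto
  have norm: "\<L> h * \<L> h - \<L> (P\<^sup>2 - D * Q\<^sup>2) \<in> \<M>"
  proof -
    have "\<L> h * \<L> h - \<L> (P\<^sup>2 - D * Q\<^sup>2) = - (\<L> h * \<L> h * N) - (\<L> P - \<L> U * \<L> h) * (\<L> P + \<L> U * \<L> h)
        + \<L> D * (\<L> Q - \<L> V * \<L> h) * (\<L> Q + \<L> V * \<L> h)"
      by (simp add: N_def power2_eq_square algebra_simps)
    also have "\<dots> \<in> \<M>"
      by (rule \<M>_add[OF \<M>_diff[OF \<M>_uminus[OF \<M>_mult[OF _ N]] \<M>_mult'[OF Ph]] \<M>_mult'[OF \<M>_mult[OF D_\<O> Qh]]])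
        (use PQ UV hO in auto)
    finally show ?thesis .
  qed
  have "leads_at (\<L> h * \<L> h) 0" using leads_at_mult[OF jh jh] jh0 by simp
  then have "leads_at (\<L> (P\<^sup>2 - D * Q\<^sup>2)) 0" using norm by (rule leads_at_cong)
  then have "leads_at (\<L> (smult (c\<^sup>2) (cf_norm D s (Suc n)))) 0"
    unfolding P_def Q_def scaled_norm .
  moreover have "leads_at (\<L> (smult c (cf_den s (Suc n)))) (- int ?q)"
    using Q_lead jh0 e(2) by (simp add: Q_def)
  ultimately show thesis using that[OF n(2) c] PQ(1) unfolding P_def by blast
qed

end

section \<open>From a degenerate convergent to a solution of the Pell equation\<close>

lemma (in valuation_subring) \<O>_factor:
  assumes "poly_to_lser (x * y) \<in> \<O>" "y \<noteq> 0" "inverse (lead_coeff y) \<in> A"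
  shows "poly_to_lser x \<in> \<O>"
proof -
  obtain c where c: "poly_to_lser (smult c y) \<in> \<O>" "poly_to_lser (smult c y) \<notin> \<M>"
    using scale_polys[of y y] assms(2) by metis
  have "c * lead_coeff y \<in> A" using c(1) by (auto simp: \<O>_poly_iff simp del: poly_to_lser_smult)
  then have "c * lead_coeff y * inverse (lead_coeff y) \<in> A" using assms(3) by blast
  \<comment> \<open>As the scaling that makes \<open>y\<close> primitive is integral,
    \<open>c * x * y\<close> stays integral and the primitive factor can be cancelled.\<close>
  then have "c \<in> A" using assms(2) by (simp add: mult.assoc)
  then have "fls_const c * poly_to_lser (x * y) \<in> \<O>" using assms(1) by blast
  then have "poly_to_lser (smult c y) * poly_to_lser x \<in> \<O>" by (simp add: algebra_simps)
  then show ?thesis using c \<O>_cancel by blast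
qed

text \<open>By \<open>lc\<close> the leading coefficients of both norms have integral inverses, so
  \<open>\<O>_factor\<close> makes \<open>?x\<close> integral with a unit as leading coefficient.
  Then \<open>c\<^sup>2\<close> is a unit too, and a scaled norm that is constant modulo \<mm>
  forces \<open>?x\<close> to be constant.\<close>

lemma (in good_finite_place) pellian_if_degenerate:
  assumes n: "n = Suc n'"
    and c: "c \<noteq> 0" and P: "\<L> (smult c (cf_num s (Suc n))) \<in> \<O>"
    and Q: "leads_at (\<L> (smult c (cf_den s (Suc n)))) (- int (degree (cf_den s (Suc n))))"
    and t: "leads_at (\<L> (smult (c\<^sup>2) (cf_norm D s (Suc n)))) 0"
    and lc: "lead_coeff (cf_partial s n) \<in> A" "lead_coeff (cf_partial s (Suc n)) \<in> A"
  shows "pellian D"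
proof -
  let ?x = "cf_norm D s (Suc n)" and ?y = "cf_norm D s n"
  define M where "M = cf_num s (Suc n) * cf_num s n - D * cf_den s (Suc n) * cf_den s n"
  note M_eqs = cf_norm_mixed[of n, folded M_def]
  \<comment> \<open>Otherwise, scaling \<open>M_eqs(2)\<close> by some \<open>e \<in> \<mm>\<close>, the last summand vanishes modulo \<open>\<mm>\<close>, and the two other
    terms have different degrees there.\<close>
  have M_O: "\<L> M \<in> \<O>"
  proof (rule ccontr)
    assume "\<L> M \<notin> \<O>"
    then obtain e where e: "e \<in> \<mm>" "\<L> (smult e M) \<in> \<O>" "\<L> (smult e M) \<notin> \<M>"
      by (rule scale_not_\<O>)
    then obtain j where j: "leads_at (\<L> (smult e M)) j" using leads_at_exists by blast
    let ?P = "smult c (cf_num s (Suc n))" and ?Q = "smult c (cf_den s (Suc n))"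
    let ?t = "smult (c\<^sup>2) ?x" and ?Z = "smult (e / c) (cf_den s n)"
    have "smult e M * ?Q = smult (e * c) (M * cf_den s (Suc n))" by (simp add: mult.commute)
    also have "\<dots> = ?t * ?Z + smult (e * (- 1) ^ n) ?P"
    proof -
      have "(-1) ^ n * cf_num s (Suc n) = smult ((-1) ^ n) (cf_num s (Suc n))"
        by (cases "even n") simp_all
      then show ?thesis unfolding M_eqs(2) using c by (simp add: smult_add_right power2_eq_square mult.assoc mult.left_commute mult.commute)
    qed
    finally have eq: "\<L> (smult e M) * \<L> ?Q - \<L> ?t * \<L> ?Z = fls_const (e * (- 1) ^ n) * \<L> ?P"
      by (metis add_diff_cancel_left' poly_to_lser_add poly_to_lser_mult poly_to_lser_smult)
    have "(- 1) ^ n \<in> A" by auto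
    then have M: "\<L> (smult e M) * \<L> ?Q - \<L> ?t * \<L> ?Z \<in> \<M>" unfolding eq using e(1) P by blast
    have lead: "leads_at (\<L> ?t * \<L> ?Z) (j + - int (degree (cf_den s (Suc n))))"
      using leads_at_cong[OF leads_at_mult[OF j Q] M] .
    then have "\<L> ?t * \<L> ?Z \<in> \<O>" by (simp add: leads_at_def)
    then have Z: "\<L> ?Z \<in> \<O>" using \<O>_cancel t leads_at_not_\<M> by (meson leads_at_def)
    have t0: "\<L> ?t \<in> \<O>" "vanishes_below (\<L> ?t) 0" using t by (auto simp: leads_at_def)
    have "vanishes_below (\<L> ?t * \<L> ?Z) (0 + fls_subdegree (\<L> ?Z))"
      using vanishes_below_mult[OF t0 Z vanishes_below_subdegree] .
    then have "fls_subdegree (\<L> ?Z) \<le> j - int (degree (cf_den s (Suc n)))"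
      using vanishes_below_leads[OF lead] by fastforce
    moreover have "- int (degree (cf_den s n)) \<le> fls_subdegree (\<L> ?Z)"
      unfolding subdegree_poly_to_lser using degree_smult_le[of "e / c" "cf_den s n"] by linarith
    moreover have "j \<le> 0" using j by (rule leads_at_poly_nonpos)
    ultimately show False using degree_cf_den_less[of n', folded n] by linarith
  qed
  have "?x * ?y = M\<^sup>2 - D" using M_eqs(1) by (simp add: algebra_simps)
  then have xy: "\<L> (?x * ?y) \<in> \<O>" using M_O D_\<O> by (simp del: poly_to_lser_mult) blast
  have inv: "inverse (lead_coeff (cf_norm D s (Suc k))) \<in> A"
    if "lead_coeff (cf_partial s (Suc k)) \<in> A" for k
  proof -
    let ?v = "(- 1) ^ Suc k * \<sigma> * inverse 2"
    have "?v \<in> A" using half_mem \<sigma>_mem(1) by (intro mult_mem power_mem uminus_mem) auto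
    moreover have "lead_coeff (cf_norm D s (Suc k)) * (lead_coeff (cf_partial s (Suc k)) * ?v) = 1"
    proof -
      have "lead_coeff (cf_norm D s (Suc k)) * (lead_coeff (cf_partial s (Suc k)) * ?v)
          = ((- 1) ^ Suc k * 2 * \<sigma>) * ?v"
        unfolding lead_coeff_cf_norm[symmetric] by (simp only: mult.assoc)
      also have "\<dots> = ((- 1) ^ Suc k * (- 1) ^ Suc k) * \<sigma>\<^sup>2"
        by (simp add: power2_eq_square)
      finally show ?thesis by (simp add: \<sigma>_sq flip: power_add)
    qed
    ultimately show ?thesis using that by (metis inverse_unique mult_mem)
  qed
  have xO: "\<L> ?x \<in> \<O>"
    using \<O>_factor[OF xy cf_norm_nonzero] inv[of n'] lc(1) by (simp add: n)
  have lx: "lead_coeff ?x \<in> A" "inverse (lead_coeff ?x) \<in> A"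
    using xO inv[of n] lc(2) by (auto simp: \<O>_poly_iff)
  then have lx_unit: "lead_coeff ?x \<notin> \<mm>" using cf_norm_nonzero by (intro not_ideal_inverse) auto
  have tO: "\<And>i. c\<^sup>2 * coeff ?x i \<in> A"
    using t by (auto simp: leads_at_def \<O>_poly_iff simp del: poly_to_lser_smult)
  have "c\<^sup>2 * lead_coeff ?x * inverse (lead_coeff ?x) \<in> A" using tO lx(2) by blast
  then have cA: "c\<^sup>2 \<in> A" using cf_norm_nonzero by (simp add: mult.assoc)
  have "c\<^sup>2 * coeff ?x 0 \<notin> \<mm>" using t by (simp add: leads_at_def poly_to_lser_nth)
  then have "c\<^sup>2 \<notin> \<mm>" using xO by (auto simp: \<O>_poly_iff)
  then have "c\<^sup>2 * lead_coeff ?x \<notin> \<mm>" using prime_ideal[OF cA lx(1)] lx_unit by blast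
  moreover have "c\<^sup>2 * coeff ?x i \<in> \<mm>" if "i > 0" for i
  proof -
    have "vanishes_below (\<L> (smult (c\<^sup>2) ?x)) 0" using t by (simp only: leads_at_def)
    moreover have "- int i < 0" using that by simp
    ultimately have "\<L> (smult (c\<^sup>2) ?x) $$ (- int i) \<in> \<mm>" unfolding vanishes_below_def by blast
    then show ?thesis by (simp only: poly_to_lser_nth_neg coeff_smult)
  qed
  ultimately have "degree ?x = 0" by blast
  then obtain b where b: "?x = [:b:]" by (rule degree_eq_zeroE)
  then have "b \<noteq> 0" using cf_norm_nonzero[of "Suc n"] by auto
  then show ?thesis
    unfolding pellian_def using b cf_den_nonzero[of n] unfolding cf_norm_def by blast
qed

theorem mainTheorem1:
  fixes D :: "'a::field_char_0 poly" and s :: "'a fls"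
  assumes "number_field TYPE('a)"
    and "lead_coeff D = 1"
    and "\<not> (\<exists>q. D = q\<^sup>2)"
    and "even (degree D)"
    and "\<not> pellian D"
    and "s\<^sup>2 = poly_to_lser D"
  shows "finite {p::nat. prime p \<and>
           \<not> infinite {n. p_in_denominator p (lead_coeff (cf_partial s n))}}"
proof -
  obtain d where d: "degree D = 2 * d" using assms(4) by blast
  interpret S: sqrt_series D s d by unfold_locales (use assms d in auto)
  \<comment> \<open>Integrality of the inverse of its leading coefficient keeps the nonzero
    \<open>G\<close> from vanishing modulo \<mm>.\<close>
  define G where "G = D - (lser_floor s)\<^sup>2"
  have G: "G \<noteq> 0" using assms(3) by (auto simp: G_def)
  \<comment> \<open>Integrality of these finitely many elements makes the place good; for almost all
    \<open>p\<close> they lie in every valuation ring above \<open>p\<close>.\<close>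
  define X where "X = insert (inverse 2) (insert (inverse (lead_coeff G)) (set (coeffs D)))"
  have "p \<in> {p. \<exists>A. prime_valuation A p \<and> \<not> X \<subseteq> A}"
    if p: "prime p" and fin: "finite {n. p_in_denominator p (lead_coeff (cf_partial s n))}" for p
  proof (rule ccontr)
    assume not_bad: "p \<notin> {p. \<exists>A. prime_valuation A p \<and> \<not> X \<subseteq> A}"
    obtain A :: "'a set" where A: "prime_valuation A p" using exists_prime_valuation[OF p] by blast
    interpret prime_valuation A p by (rule A)
    have X: "X \<subseteq> A" using not_bad A by blast
    have "coeff D i \<in> insert 0 (set (coeffs D))" for i
      unfolding range_coeff[symmetric] by simp
    then have "coeff D i \<in> A" for i
      using X by (metis X_def insert_iff subset_iff zero_mem)
    then have D_O: "poly_to_lser D \<in> \<O>" by (simp add: \<O>_poly_iff)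
    have "poly_to_lser G \<notin> \<M>"
    proof
      assume "poly_to_lser G \<in> \<M>"
      then have "lead_coeff G \<in> \<mm>" by (simp add: \<M>_poly_iff)
      moreover have "inverse (lead_coeff G) \<in> A" using X by (simp add: X_def)
      ultimately show False using G ideal_mem[of "lead_coeff G"] not_ideal_inverse[of "lead_coeff G"] by simp
    qed
    then interpret good_finite_place A D s d
    proof unfold_locales
      obtain R where "finite R" "\<And>x. x \<in> A \<Longrightarrow> \<exists>r\<in>R. x - r \<in> \<mm>" "R \<subseteq> A"
        using finite_residues[OF assms(1)] by blast
      then show "\<exists>R. finite R \<and> R \<subseteq> A \<and> (\<forall>x\<in>A. \<exists>r\<in>R. x - r \<in> \<mm>)" by blast
    qed (use X D_O in \<open>auto simp: X_def G_def\<close>)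
    obtain n0 where n0: "\<And>n. n \<ge> n0 \<Longrightarrow> lead_coeff (cf_partial s n) \<in> A"
    proof -
      obtain b where b: "\<And>n. p_in_denominator p (lead_coeff (cf_partial s n)) \<Longrightarrow> n < b"
        using fin finite_nat_set_iff_bounded by auto
      then show thesis using that[of b] not_p_in_denominator_mem by (meson not_le)
    qed
    \<comment> \<open>The bound \<open>Suc n0\<close> also makes \<open>n\<close> positive, so that
      the leading coefficient formula applies to the norms of index \<open>n\<close> and
      \<open>Suc n\<close>.\<close>
    obtain n c where n: "n \<ge> Suc n0" "c \<noteq> 0" "\<L> (smult c (cf_num s (Suc n))) \<in> \<O>"
      "leads_at (\<L> (smult c (cf_den s (Suc n)))) (- int (degree (cf_den s (Suc n))))"
      "leads_at (\<L> (smult (c\<^sup>2) (cf_norm D s (Suc n)))) 0"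
      by (rule degenerate_convergents)
    from n(1) obtain n' where "n = Suc n'" by (cases n) auto
    then have "pellian D" using pellian_if_degenerate n n0[of n] n0[of "Suc n"] by auto
    then show False using assms(5) by simp
  qed
  then have "{p::nat. prime p \<and> \<not> infinite {n. p_in_denominator p (lead_coeff (cf_partial s n))}}
      \<subseteq> {p. \<exists>A. prime_valuation A p \<and> \<not> X \<subseteq> A}" by blast
  moreover have "finite {p. \<exists>A. prime_valuation A p \<and> \<not> X \<subseteq> A}"
    by (rule number_field_almost_all_mem[OF assms(1)]) (simp add: X_def)
  ultimately show ?thesis by (rule finite_subset)
qed

end
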